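(* Let $\mu\in\mathcal M(E)$ and let $a<\hat I(\mu)$. Then there exists a $\tau$-neighborhood $N_\mu$ of $\mu$ such that $$\limsup_{t\to\infty}\frac1t\,\sup_{x\in E}\log P^x(L_t\in N_\mu)\le -a .$$
   Context: Setting. $E$ is a topological Lusin space: a Hausdorff space for which there exist a Polish space $S$ and a continuous bijection $\varphi:S\to E$. $\mathcal B(E)$ is its Borel $\sigma$-algebra, assumed generated by the real-valued continuous functions on $E$. $m$ is a $\sigma$-finite measure on $(E,\mathcal B(E))$ with $m(E)>0$. $B_b(E)$ ($B_b^+(E)$) denotes bounded (bounded nonnegative) measurable functions; $\mathcal M(E)$ the probability measures on $(E,\mathcal B(E))$. $p_t(x,\cdot)$, $t\ge0$, $x\in E$, is a transition probability function: each $p_t(x,\cdot)$ is a probability measure, $(t,x)\mapsto p_t(x,A)$ is jointly measurable for each $A$, and $p_0(x,A)=1_A(x)$; write $p_tf(x)=\int f(y)p_t(x,dy)$. There is a semigroup $(T_t)_{t\ge0}$ on $L_2(m)$, strongly continuous ($\|T_tf-f\|_2\to0$ as $t\to0$ for all $f\in L_2(m)$), such that for every bounded measurable $f$ with $\int f^2dm<\infty$, $p_tf$ is a representative of $T_tf$. There is a progressively measurable Markov process $(\Omega,\mathcal F^o_t,X_t,P^x)_{t\ge0,x\in E}$ with transition function $p_t$, $X_t(\omega)=\omega(t)$, $\mathcal F^o_t=\sigma(X_s,s\le t)$, $P^x(X_0=x)=1$ and infinite lifetime. Definitions. $D=\{u\in B_b^+(E):\int u\,dm<\infty\}$. $D_1$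 is the set of functions of the form $v=\frac1t\int_0^t p_s\tilde u\,ds$ with $\tilde u=p_\eta u$, $u\in D$, $t>0$, $\eta\ge0$; for such a representation put $\hat Lv=\frac1t(p_t\tilde u-\tilde u)$. For $\mu\in\mathcal M(E)$, $$\hat I(\mu)=-\inf\Big\{\int\frac{\hat Lv}{v+\varepsilon}\,d\mu:\ v\in D_1\text{ (any representation)},\ \varepsilon>0\Big\}.$$ Empirical measures: $L_t(\omega,A)=\frac1t\int_0^t1_A(X_s(\omega))\,ds$. A $\tau$-neighborhood of $\mu\in\mathcal M(E)$ is a set $\{\nu\in\mathcal M(E):|\int f_jd\nu-\int f_jd\mu|<\varepsilon,\ 1\le j\le r\}$ with $\varepsilon>0$ and $f_1,\dots,f_r\in B_b(E)$. *)

theory Defs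
  imports "HOL-Probability.Probability"
begin

definition Bb :: "('e::topological_space \<Rightarrow> real) set" where
  "Bb = {f. f \<in> borel_measurable borel \<and> bounded (range f)}"

definition probs :: "('e::topological_space) measure set" where
  "probs = {\<nu>. prob_space \<nu> \<and> sets \<nu> = sets borel}"

definition pf :: "(real \<Rightarrow> 'e \<Rightarrow> 'e measure) \<Rightarrow> real \<Rightarrow> ('e \<Rightarrow> real) \<Rightarrow> 'e \<Rightarrow> real" where
  "pf p t f x = integral\<^sup>L (p t x) f"

definition L2 :: "('e::topological_space) measure \<Rightarrow> ('e \<Rightarrow> real) set" where
  "L2 m = {f. f \<in> borel_measurable borel \<and> integrable m (\<lambda>x. (f x)\<^sup>2)}"

definition Dset :: "('e::topological_space) measure \<Rightarrow> ('e \<Rightarrow> real) set" where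
  "Dset m = {u. u \<in> Bb \<and> (\<forall>x. 0 \<le> u x) \<and> (\<integral>\<^sup>+ x. ennreal (u x) \<partial>m) < \<infinity>}"

definition vrep :: "(real \<Rightarrow> 'e \<Rightarrow> 'e measure) \<Rightarrow> ('e \<Rightarrow> real) \<Rightarrow> real \<Rightarrow> real \<Rightarrow> 'e \<Rightarrow> real" where
  "vrep p u t \<eta> x = (1 / t) * set_lebesgue_integral lborel {0..t} (\<lambda>s. pf p s (pf p \<eta> u) x)"

definition Lhat_rep :: "(real \<Rightarrow> 'e \<Rightarrow> 'e measure) \<Rightarrow> ('e \<Rightarrow> real) \<Rightarrow> real \<Rightarrow> real \<Rightarrow> 'e \<Rightarrow> real" where
  "Lhat_rep p u t \<eta> x = (1 / t) * (pf p t (pf p \<eta> u) x - pf p \<eta> u x)"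

text \<open>\<open>\<hat>I\<close>(mu) = - inf over all representations (u,t,eta) of v in D_1 and eps > 0.\<close>
definition Ihat :: "(real \<Rightarrow> 'e \<Rightarrow> 'e measure) \<Rightarrow> ('e::topological_space) measure \<Rightarrow> 'e measure \<Rightarrow> ereal" where
  "Ihat p m \<mu> = - (INF r \<in> {(u, t, \<eta>, \<epsilon>). u \<in> Dset m \<and> t > 0 \<and> \<eta> \<ge> 0 \<and> \<epsilon> > 0}.
      (case r of (u, t, \<eta>, \<epsilon>) \<Rightarrow>
        ereal (integral\<^sup>L \<mu> (\<lambda>x. Lhat_rep p u t \<eta> x / (vrep p u t \<eta> x + \<epsilon>)))))"

definition emp :: "real \<Rightarrow> (real \<Rightarrow> 'e::topological_space) \<Rightarrow> 'e measure" where
  "emp t \<omega> = scale_measure (ennreal (1 / t)) (distr (restrict_space lborel {0..t}) borel \<omega>)"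

definition tau_nbhd :: "('e::topological_space) measure \<Rightarrow> ('e \<Rightarrow> real) set \<Rightarrow> real \<Rightarrow> 'e measure set" where
  "tau_nbhd \<mu> F \<epsilon> = {\<nu> \<in> probs. \<forall>f \<in> F. \<bar>integral\<^sup>L \<nu> f - integral\<^sup>L \<mu> f\<bar> < \<epsilon>}"

definition elog :: "ennreal \<Rightarrow> ereal" where
  "elog r = (if r = 0 then -\<infinity> else if r = \<top> then \<infinity> else ereal (ln (enn2real r)))"

definition Fo :: "(real \<Rightarrow> 'e::topological_space) set \<Rightarrow> real \<Rightarrow> (real \<Rightarrow> 'e) measure" where
  "Fo \<Omega> t = sigma \<Omega> {{\<omega> \<in> \<Omega>. \<omega> s \<in> A} | s A. 0 \<le> s \<and> s \<le> t \<and> A \<in> sets borel}"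

definition Foo :: "(real \<Rightarrow> 'e::topological_space) set \<Rightarrow> (real \<Rightarrow> 'e) measure" where
  "Foo \<Omega> = sigma \<Omega> {{\<omega> \<in> \<Omega>. \<omega> s \<in> A} | s A. 0 \<le> s \<and> A \<in> sets borel}"

end

theory Submission
  imports Defs
begin

text \<open>
  Choose \<open>v = vrep p u t\<^sub>0 \<eta>\<close> and \<open>\<epsilon>\<close> that make the infimum in \<open>Ihat\<close> less than \<open>- a\<close>, and put
  \<open>w = v + \<epsilon>\<close>, \<open>g = Lhat_rep p u t\<^sub>0 \<eta>\<close> and \<open>V = g / w\<close>. Since \<open>p\<^sub>s w = w + \<integral>\<^sub>0\<^sup>s p\<^sub>r g dr\<close>, the
  Feynman-Kac functional \<open>M\<^sub>t = w(X\<^sub>t) exp (- \<integral>\<^sub>0\<^sup>t V(X\<^sub>s) ds)\<close> has constant expectation \<open>w(x)\<close>. As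
  \<open>\<epsilon> \<le> w \<le> K\<close>, the exponential \<open>exp (- \<integral>\<^sub>0\<^sup>t V(X\<^sub>s) ds)\<close> has expectation at most \<open>K / \<epsilon>\<close>, uniformly in
  \<open>x\<close> and \<open>t\<close>. On the \<open>\<tau>\<close>-neighborhood of \<open>\<mu>\<close> given by \<open>V\<close> with a small enough radius this exponential
  exceeds \<open>exp (a t)\<close>, and Markov's inequality gives the exponential bound. The paths have no
  regularity, so constancy of the expectation of \<open>M\<close> comes from increments over \<open>[t, t + h]\<close>
  being of order \<open>h\<^sup>2\<close>.
\<close>

section \<open>Real-variable estimates: exponential remainder and a criterion for constancy\<close>

text \<open>The tangent line at \<open>0\<close> lies below \<open>exp\<close>, so only the upper
  bound needs work. For negative \<open>y\<close> it comes from \<open>1 - y \<le> exp (- y)\<close>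
  combined with \<open>(1 + y + y\<^sup>2) * (1 - y) = 1 - y ^ 3 \<ge> 1\<close>.\<close>

lemma exp_remainder_abs_le:
  fixes y :: real
  assumes "\<bar>y\<bar> \<le> 1"
  shows "\<bar>exp y - 1 - y\<bar> \<le> y\<^sup>2"
proof -
  have "exp y \<le> 1 + y + y\<^sup>2"
  proof (cases "y \<ge> 0")
    case True
    then show ?thesis using assms exp_bound by auto
  next
    case False
    have "1 - y \<le> exp (- y)"
      using exp_ge_add_one_self[of "- y"] by simp
    then have "exp y * (1 - y) \<le> 1"
      using mult_left_mono[of "1 - y" "exp (- y)" "exp y"] by (simp add: exp_minus)
    also have "1 \<le> (1 + y + y\<^sup>2) * (1 - y)"
    proof -
      have "(1 + y + y\<^sup>2) * (1 - y) = 1 + (- y) ^ 3"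
        by (simp add: algebra_simps power2_eq_square power3_eq_cube)
      then show ?thesis
        using False by simp
    qed
    finally show ?thesis
      using False by simp
  qed
  then show ?thesis
    using exp_ge_add_one_self[of y] zero_le_power2[of y] by linarith
qed

text \<open>Difference quotients at \<open>x\<close> are at most
  \<open>C * \<bar>y - x\<bar>\<close>, so the derivative exists and vanishes at every point of
  \<open>{0..T}\<close>. Differentiability of \<Phi> is thus a conclusion rather than an
  input.\<close>

lemma constant_if_quadratic_increments:
  fixes \<Phi> :: "real \<Rightarrow> real"
  assumes "0 \<le> T" "0 < d"
    and incr: "\<And>t h. 0 \<le> t \<Longrightarrow> 0 < h \<Longrightarrow> h \<le> d \<Longrightarrow> t + h \<le> T \<Longrightarrow> \<bar>\<Phi> (t + h) - \<Phi> t\<bar> \<le> C * h\<^sup>2"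
  shows "\<Phi> T = \<Phi> 0"
proof -
  have "(\<Phi> has_field_derivative 0) (at x within {0..T})" if x: "x \<in> {0..T}" for x
    unfolding has_field_derivative_iff
  proof (rule Lim_null_comparison)
    have bound: "\<bar>\<Phi> y - \<Phi> x\<bar> \<le> C * (y - x)\<^sup>2" if "y \<in> {0..T}" "y \<noteq> x" "dist y x < d" for y
      using incr[of x "y - x"] incr[of y "x - y"] that x
      by (cases "x < y") (auto simp: dist_real_def power2_commute abs_minus_commute)
    show "\<forall>\<^sub>F y in at x within {0..T}. norm ((\<Phi> y - \<Phi> x) / (y - x)) \<le> C * \<bar>y - x\<bar>"
      unfolding eventually_at
    proof (intro exI[of _ d] conjI ballI impI assms(2))
      fix y assume y: "y \<in> {0..T}" "y \<noteq> x \<and> dist y x < d"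
      then have "\<bar>\<Phi> y - \<Phi> x\<bar> \<le> (C * \<bar>y - x\<bar>) * \<bar>y - x\<bar>"
        using bound[of y] by (simp add: power2_eq_square mult.assoc)
      then show "norm ((\<Phi> y - \<Phi> x) / (y - x)) \<le> C * \<bar>y - x\<bar>"
        using y by (simp add: divide_le_eq)
    qed
    show "((\<lambda>y. C * \<bar>y - x\<bar>) \<longlongrightarrow> 0) (at x within {0..T})"
      by (auto intro!: tendsto_eq_intros)
  qed
  then obtain c where "\<forall>x\<in>{0..T}. \<Phi> x = c"
    using has_field_derivative_zero_constant[of "{0..T}" \<Phi>] by auto
  then show ?thesis
    using assms(1) by auto
qed

section \<open>Lebesgue integrals over compact intervals: bounds, splitting, parameters,
  Fubini\<close>

text \<open>The auxiliary \<open>f'\<close> is a Borel function on the whole line that extends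
  \<open>f\<close> from the interval. This form suits \<open>pf p s f x\<close> and path
  functionals, whose measurability is known only for times in a restricted range.\<close>

lemma set_integrable_interval_bounded:
  fixes f f' :: "real \<Rightarrow> real"
  assumes meas: "f' \<in> borel_measurable borel"
    and eq: "\<And>s. s \<in> {a..b} \<Longrightarrow> f s = f' s"
    and bnd: "\<And>s. s \<in> {a..b} \<Longrightarrow> \<bar>f s\<bar> \<le> B"
  shows "set_integrable lborel {a..b} f"
proof -
  have "set_integrable lborel {a..b} f'"
    unfolding set_integrable_def
    using meas eq bnd
    by (intro integrableI_bounded_set_indicator[where B = B]) (auto simp: emeasure_lborel_Icc_eq)
  then show ?thesis
    using eq by (subst set_integrable_cong[OF refl refl, of _ f f']) auto
qed

lemma set_integral_interval_bound:
  fixes f :: "real \<Rightarrow> real"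
  assumes int: "set_integrable lborel {a..b} f" and "a \<le> b"
    and bnd: "\<And>s. s \<in> {a..b} \<Longrightarrow> \<bar>f s\<bar> \<le> B"
  shows "\<bar>LINT s:{a..b}|lborel. f s\<bar> \<le> B * (b - a)"
proof -
  have "\<bar>LINT s:{a..b}|lborel. f s\<bar> \<le> (LINT s:{a..b}|lborel. \<bar>f s\<bar>)"
    using set_integral_norm_bound[OF int] by simp
  also have "\<dots> \<le> (LINT s:{a..b}|lborel. B)"
    using set_integrable_norm[OF int] bnd
    by (intro set_integral_mono) (auto simp: set_integrable_def emeasure_lborel_Icc_eq)
  also have "\<dots> = B * (b - a)"
    using assms(2) by (simp add: set_lebesgue_integral_def)
  finally show ?thesis .
qed

lemma set_integral_interval_split_shift:
  fixes f :: "real \<Rightarrow> real"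
  assumes int: "set_integrable lborel {0..a + b} f" and "0 \<le> a" "0 \<le> b"
  shows "(LINT s:{0..a + b}|lborel. f s) = (LINT s:{0..a}|lborel. f s) + (LINT s:{0..b}|lborel. f (a + s))"
    and "set_integrable lborel {0..b} (\<lambda>s. f (a + s))"
proof -
  have int1: "set_integrable lborel {0..a} f" and int2: "set_integrable lborel {a..a + b} f"
    using assms by (auto intro: set_integrable_subset)
  have ind: "indicator {a..a + b} (a + s) = (indicator {0..b} s :: real)" for s
    by (auto simp: indicator_def)
  \<comment> \<open>The closed intervals \<open>{0..a}\<close> and \<open>{a..a + b}\<close> share
    the point \<open>a\<close>, so the indicators add up only outside a Lebesgue null set.\<close>
  have "(LINT s:{0..a + b}|lborel. f s)
      = (\<integral>s. indicator {0..a} s *\<^sub>R f s + indicator {a..a + b} s *\<^sub>R f s \<partial>lborel)"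
    unfolding set_lebesgue_integral_def
    using int int1 int2 assms(2,3) AE_lborel_singleton[of a]
    by (intro integral_cong_AE)
       (auto simp: set_integrable_def indicator_def elim!: eventually_mono)
  also have "\<dots> = (LINT s:{0..a}|lborel. f s) + (LINT s:{a..a + b}|lborel. f s)"
    using int1 int2 unfolding set_lebesgue_integral_def set_integrable_def by simp
  also have "(LINT s:{a..a + b}|lborel. f s) = (LINT s:{0..b}|lborel. f (a + s))"
    unfolding set_lebesgue_integral_def
    by (subst lborel_integral_real_affine[of 1 _ a]) (simp_all add: ind)
  finally show "(LINT s:{0..a + b}|lborel. f s)
      = (LINT s:{0..a}|lborel. f s) + (LINT s:{0..b}|lborel. f (a + s))" .
  show "set_integrable lborel {0..b} (\<lambda>s. f (a + s))"
    using int2 lborel_integrable_real_affine_iff[of 1 "\<lambda>s. indicator {a..a + b} s *\<^sub>R f s" a]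
    unfolding set_integrable_def by (simp add: ind)
qed

text \<open>Here \<open>k'\<close> is a jointly measurable extension of \<open>k\<close> from the
  time interval to all of the real line; the integral in the first coordinate is taken after
  swapping the coordinates.\<close>

lemma set_integral_measurable_parameter:
  fixes k :: "real \<Rightarrow> 'a \<Rightarrow> real"
  assumes meas: "k' \<in> borel_measurable (borel \<Otimes>\<^sub>M N)"
    and eq: "\<And>r \<omega>. r \<in> {a..b} \<Longrightarrow> \<omega> \<in> space N \<Longrightarrow> k r \<omega> = k' (r, \<omega>)"
  shows "(\<lambda>\<omega>. LINT r:{a..b}|lborel. k r \<omega>) \<in> borel_measurable N"
proof -
  have "(\<lambda>(\<omega>, r). indicator {a..b} r * k' (r, \<omega>)) \<in> borel_measurable (N \<Otimes>\<^sub>M lborel)"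
  proof -
    have "(\<lambda>z. (snd z, fst z)) \<in> measurable (N \<Otimes>\<^sub>M lborel) (borel \<Otimes>\<^sub>M N)"
      by measurable
    from measurable_compose[OF this meas] show ?thesis
      by (simp add: case_prod_beta')
  qed
  then have "(\<lambda>\<omega>. \<integral>r. indicator {a..b} r * k' (r, \<omega>) \<partial>lborel) \<in> borel_measurable N"
    by (rule lborel.borel_measurable_lebesgue_integral)
  moreover have "(\<integral>r. indicator {a..b} r * k' (r, \<omega>) \<partial>lborel) = (LINT r:{a..b}|lborel. k r \<omega>)"
    if "\<omega> \<in> space N" for \<omega>
    unfolding set_lebesgue_integral_def using eq that
    by (intro Bochner_Integration.integral_cong) (auto simp: indicator_def)
  ultimately show ?thesis
    by (simp cong: measurable_cong)
qed

lemma set_integral_Fubini_bounded: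
  fixes k :: "real \<Rightarrow> 'a \<Rightarrow> real"
  assumes M: "prob_space M"
    and meas[measurable]: "k' \<in> borel_measurable (borel \<Otimes>\<^sub>M M)"
    and eq: "\<And>r \<omega>. r \<in> {a..b} \<Longrightarrow> \<omega> \<in> space M \<Longrightarrow> k r \<omega> = k' (r, \<omega>)"
    and bnd: "\<And>r \<omega>. r \<in> {a..b} \<Longrightarrow> \<omega> \<in> space M \<Longrightarrow> \<bar>k r \<omega>\<bar> \<le> B"
  shows "(\<integral>\<omega>. (LINT r:{a..b}|lborel. k r \<omega>) \<partial>M) = (LINT r:{a..b}|lborel. (\<integral>\<omega>. k r \<omega> \<partial>M))"
    and "set_integrable lborel {a..b} (\<lambda>r. \<integral>\<omega>. k r \<omega> \<partial>M)"
    and "integrable M (\<lambda>\<omega>. LINT r:{a..b}|lborel. k r \<omega>)"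
proof -
  interpret Q: prob_space M by fact
  interpret pair_sigma_finite lborel M
    by (intro pair_sigma_finite.intro sigma_finite_lborel Q.sigma_finite_measure_axioms)
  let ?f = "\<lambda>r \<omega>. indicator {a..b} r * k' (r, \<omega>)"
  \<comment> \<open>The integrand is bounded on the rectangle
    \<open>{a..b} \<times> space M\<close>, which has finite product measure because
    \<open>M\<close> has total mass \<open>1\<close>.\<close>
  have "integrable (lborel \<Otimes>\<^sub>M M) (\<lambda>z. indicator ({a..b} \<times> space M) z *\<^sub>R k' z)"
  proof (rule integrableI_bounded_set_indicator[where B = B])
    show "emeasure (lborel \<Otimes>\<^sub>M M) ({a..b} \<times> space M) < \<infinity>"
      by (subst Q.emeasure_pair_measure_Times) (auto simp: emeasure_lborel_Icc_eq Q.emeasure_space_1)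
    show "AE z in lborel \<Otimes>\<^sub>M M. z \<in> {a..b} \<times> space M \<longrightarrow> norm (k' z) \<le> B"
      using eq bnd by (auto intro!: AE_I2)
  qed auto
  then have int: "integrable (lborel \<Otimes>\<^sub>M M) (case_prod ?f)"
    by (rule Bochner_Integration.integrable_cong[THEN iffD1, rotated -1])
       (auto simp: space_pair_measure indicator_def)
  have k: "(LINT r:{a..b}|lborel. k r \<omega>) = (\<integral>r. ?f r \<omega> \<partial>lborel)" if "\<omega> \<in> space M" for \<omega>
    unfolding set_lebesgue_integral_def using eq that
    by (intro Bochner_Integration.integral_cong) (auto simp: indicator_def)
  have k': "indicator {a..b} r *\<^sub>R (\<integral>\<omega>. k r \<omega> \<partial>M) = (\<integral>\<omega>. ?f r \<omega> \<partial>M)" for r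
    using eq by (auto simp: indicator_def intro!: Bochner_Integration.integral_cong)
  show "(\<integral>\<omega>. (LINT r:{a..b}|lborel. k r \<omega>) \<partial>M) = (LINT r:{a..b}|lborel. (\<integral>\<omega>. k r \<omega> \<partial>M))"
  proof -
    have "(\<integral>\<omega>. (LINT r:{a..b}|lborel. k r \<omega>) \<partial>M) = (\<integral>\<omega>. (\<integral>r. ?f r \<omega> \<partial>lborel) \<partial>M)"
      by (intro Bochner_Integration.integral_cong refl k)
    also have "\<dots> = (\<integral>r. (\<integral>\<omega>. ?f r \<omega> \<partial>M) \<partial>lborel)"
      by (rule Fubini_integral[OF int])
    finally show ?thesis
      unfolding set_lebesgue_integral_def k' .
  qed
  show "set_integrable lborel {a..b} (\<lambda>r. \<integral>\<omega>. k r \<omega> \<partial>M)"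
    unfolding set_integrable_def k' using integrable_fst[OF int] by simp
  show "integrable M (\<lambda>\<omega>. LINT r:{a..b}|lborel. k r \<omega>)"
    using integrable_snd[OF int] by (simp add: k cong: Bochner_Integration.integrable_cong)
qed

section \<open>Bounded Borel functions\<close>

lemma BbE:
  assumes "f \<in> Bb"
  obtains B where "B \<ge> 0" "\<And>x. \<bar>f x\<bar> \<le> B"
proof -
  obtain B where "\<And>x. \<bar>f x\<bar> \<le> B"
    using assms by (auto simp: Bb_def bounded_iff)
  then show ?thesis
    using that[of B] by (meson abs_ge_zero order_trans)
qed

lemma BbI:
  assumes "f \<in> borel_measurable borel" "\<And>x. \<bar>f x\<bar> \<le> B"
  shows "f \<in> Bb"
  using assms by (auto simp: Bb_def bounded_iff)

lemma Bb_measurable: "f \<in> Bb \<Longrightarrow> f \<in> borel_measurable borel"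
  by (simp add: Bb_def)

section \<open>Path integrals, the Markov family and measurability of its paths\<close>

text \<open>This is \<open>t\<close> times the integral of \<open>V\<close> against the empirical
  measure \<open>emp t \<omega>\<close>, as \<open>integral_emp\<close> shows for positive
  \<open>t\<close>, Borel \<open>V\<close> and paths in \<Omega>.\<close>

definition path_int :: "('e \<Rightarrow> real) \<Rightarrow> real \<Rightarrow> (real \<Rightarrow> 'e) \<Rightarrow> real" where
  "path_int V t \<omega> = (LINT s:{0..t}|lborel. V (\<omega> s))"

text \<open>The Markov property enters for sets only: an event \<Lambda> of the past and one Borel
  set at a later time. Its extension to bounded functions is carried out below.\<close>

locale markov_family =
  fixes p :: "real \<Rightarrow> 'e::topological_space \<Rightarrow> 'e measure"
    and \<Omega> :: "(real \<Rightarrow> 'e) set"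
    and P :: "'e \<Rightarrow> (real \<Rightarrow> 'e) measure"
  assumes p_prob: "\<And>t x. t \<ge> 0 \<Longrightarrow> prob_space (p t x) \<and> sets (p t x) = sets borel"
    and p_meas: "\<And>A. A \<in> sets borel \<Longrightarrow>
      (\<lambda>(t, x). emeasure (p t x) A) \<in> borel_measurable
        (restrict_space ((borel :: real measure) \<Otimes>\<^sub>M (borel :: 'e measure)) ({0..} \<times> UNIV))"
    and P_prob: "\<And>x. prob_space (P x) \<and> sets (P x) = sets (Foo \<Omega>)"
    and P_start: "\<And>x. emeasure (P x) {\<omega> \<in> \<Omega>. \<omega> 0 = x} = 1"
    and P_markov: "\<And>x t s A \<Lambda>. t \<ge> 0 \<Longrightarrow> s \<ge> 0 \<Longrightarrow> A \<in> sets borel \<Longrightarrow> \<Lambda> \<in> sets (Fo \<Omega> t) \<Longrightarrow>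
      emeasure (P x) (\<Lambda> \<inter> {\<omega> \<in> \<Omega>. \<omega> (t + s) \<in> A}) =
      set_nn_integral (P x) \<Lambda> (\<lambda>\<omega>. emeasure (p s (\<omega> t)) A)"
    and X_prog: "\<And>t. t \<ge> 0 \<Longrightarrow>
      (\<lambda>(s, \<omega>). \<omega> s) \<in> measurable (restrict_space (borel :: real measure) {0..t} \<Otimes>\<^sub>M Fo \<Omega> t) borel"
begin

lemma space_Fo [simp]: "space (Fo \<Omega> t) = \<Omega>"
  unfolding Fo_def by (rule space_measure_of) auto

lemma space_P [simp]: "space (P x) = \<Omega>"
proof -
  have "space (Foo \<Omega>) = \<Omega>"
    unfolding Foo_def by (rule space_measure_of) auto
  then show ?thesis
    using P_prob[of x] sets_eq_imp_space_eq[of "P x" "Foo \<Omega>"] by simp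
qed

lemma measure_P_space [simp]: "measure (P x) \<Omega> = 1"
  using prob_space.prob_space[of "P x"] P_prob by simp

lemma subalgebra_P_Fo: "subalgebra (P x) (Fo \<Omega> t)"
proof -
  have "sets (Fo \<Omega> t) \<subseteq> sets (Foo \<Omega>)"
    unfolding Fo_def Foo_def
    by (subst (1 2) sets_measure_of) (auto intro!: sigma_sets_subseteq)
  then show ?thesis
    using P_prob[of x] by (simp add: subalgebra_def)
qed

lemma subalgebra_Fo_mono:
  assumes "s \<le> t"
  shows "subalgebra (Fo \<Omega> t) (Fo \<Omega> s)"
proof -
  have "{{\<omega> \<in> \<Omega>. \<omega> r \<in> A} | r A. 0 \<le> r \<and> r \<le> s \<and> A \<in> sets borel}
      \<subseteq> {{\<omega> \<in> \<Omega>. \<omega> r \<in> A} | r A. 0 \<le> r \<and> r \<le> t \<and> A \<in> sets borel}"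
    using assms order_trans by blast
  then have "sets (Fo \<Omega> s) \<subseteq> sets (Fo \<Omega> t)"
    unfolding Fo_def by (subst (1 2) sets_measure_of) (auto intro!: sigma_sets_mono')
  then show ?thesis
    by (simp add: subalgebra_def)
qed

lemma measurable_P_if_Fo: "Z \<in> measurable (Fo \<Omega> t) N \<Longrightarrow> Z \<in> measurable (P x) N"
  using measurable_from_subalg[OF subalgebra_P_Fo] .

lemma coord_measurable_Fo:
  assumes "0 \<le> s" "s \<le> t"
  shows "(\<lambda>\<omega>. \<omega> s) \<in> measurable (Fo \<Omega> t) borel"
proof (rule measurableI)
  fix A :: "'e set" assume "A \<in> sets borel"
  then have "{\<omega> \<in> \<Omega>. \<omega> s \<in> A} \<in> sets (Fo \<Omega> t)"
    unfolding Fo_def using assms by (subst sets_measure_of) (auto intro!: sigma_sets.Basic)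
  then show "(\<lambda>\<omega>. \<omega> s) -` A \<inter> space (Fo \<Omega> t) \<in> sets (Fo \<Omega> t)"
    by (simp add: vimage_def Int_def conj_commute)
qed simp

lemma coord_measurable_P: "0 \<le> s \<Longrightarrow> (\<lambda>\<omega>. \<omega> s) \<in> measurable (P x) borel"
  using measurable_P_if_Fo[OF coord_measurable_Fo] by blast

text \<open>Clamping the time to \<open>{0..T}\<close> turns progressive measurability, which
  concerns a restricted time space, into measurability on the full product, where it can be combined
  with integration over \<open>lborel\<close>.\<close>

lemma path_measurable_Fo:
  assumes "0 \<le> T"
  shows "(\<lambda>z. snd z (max 0 (min T (fst z)))) \<in> measurable (borel \<Otimes>\<^sub>M Fo \<Omega> T) borel"
proof -
  have "(\<lambda>z. (max 0 (min T (fst z)), snd z))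
      \<in> measurable ((borel :: real measure) \<Otimes>\<^sub>M Fo \<Omega> T) (restrict_space borel {0..T} \<Otimes>\<^sub>M Fo \<Omega> T)"
    using assms by (intro measurable_Pair measurable_restrict_space2) (auto simp: space_pair_measure)
  from measurable_compose[OF this X_prog[OF assms]] show ?thesis
    by simp
qed

lemma path_measurable_P:
  assumes "0 \<le> T"
  shows "(\<lambda>z. snd z (max 0 (min T (fst z)))) \<in> measurable (borel \<Otimes>\<^sub>M P x) borel"
proof -
  have "(\<lambda>z. (fst z, snd z)) \<in> measurable ((borel :: real measure) \<Otimes>\<^sub>M P x) (borel \<Otimes>\<^sub>M Fo \<Omega> T)"
    by (intro measurable_Pair measurable_fst measurable_compose[OF measurable_snd]
        measurable_P_if_Fo[where t = T]) auto
  from measurable_compose[OF this path_measurable_Fo[OF assms]] show ?thesis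
    by simp
qed

section \<open>The transition operators on bounded functions\<close>

text \<open>The time is clamped at \<open>0\<close> since \<open>p t x\<close> is known to be a
  probability measure only for nonnegative \<open>t\<close>. Values in
  \<open>subprob_algebra\<close> make the lemmas on \<open>bind\<close> and on integrals over
  kernels applicable.\<close>

lemma kernel_measurable:
  "(\<lambda>z. p (max 0 (fst z)) (snd z)) \<in> measurable (borel \<Otimes>\<^sub>M borel) (subprob_algebra borel)"
proof (rule measurable_subprob_algebra)
  fix A :: "'e set" assume A: "A \<in> sets borel"
  have "(\<lambda>z. (max 0 (fst z), snd z))
      \<in> measurable ((borel :: real measure) \<Otimes>\<^sub>M (borel :: 'e measure))
          (restrict_space (borel \<Otimes>\<^sub>M borel) ({0..} \<times> UNIV))"
    by (intro measurable_restrict_space2) (auto simp: space_pair_measure)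
  from measurable_compose[OF this p_meas[OF A]]
  show "(\<lambda>z. emeasure (p (max 0 (fst z)) (snd z)) A) \<in> borel_measurable (borel \<Otimes>\<^sub>M borel)"
    by simp
qed (use p_prob in \<open>auto intro: prob_space_imp_subprob_space\<close>)

lemma kernel_measurable_fixed_time:
  assumes "0 \<le> s"
  shows "p s \<in> measurable borel (subprob_algebra borel)"
  using measurable_compose[OF _ kernel_measurable, of "\<lambda>x. (s, x)" borel] assms
  by (simp add: measurable_Pair)

lemma pf_measurable_joint:
  assumes "f \<in> borel_measurable borel"
  shows "(\<lambda>z. pf p (max 0 (fst z)) f (snd z)) \<in> borel_measurable (borel \<Otimes>\<^sub>M borel)"
  unfolding pf_def
  by (rule measurable_compose[OF kernel_measurable integral_measurable_subprob_algebra[OF assms]])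

lemma integrable_kernel:
  assumes "0 \<le> s" "f \<in> Bb"
  shows "integrable (p s x) f"
proof -
  interpret prob_space "p s x" using p_prob[OF assms(1)] by simp
  obtain B where "\<And>x. \<bar>f x\<bar> \<le> B" using BbE[OF assms(2)] by metis
  then show ?thesis
    using Bb_measurable[OF assms(2)] p_prob[OF assms(1), of x]
    by (intro integrable_const_bound[where B = B]) (auto cong: measurable_cong_sets)
qed

lemma pf_abs_le:
  assumes "0 \<le> s" "f \<in> Bb" "\<And>x. \<bar>f x\<bar> \<le> B"
  shows "\<bar>pf p s f x\<bar> \<le> B"
proof -
  interpret prob_space "p s x" using p_prob[OF assms(1)] by simp
  have "\<bar>pf p s f x\<bar> \<le> (\<integral>y. \<bar>f y\<bar> \<partial>p s x)"
    unfolding pf_def by (rule integral_abs_bound)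
  also have "\<dots> \<le> (\<integral>y. B \<partial>p s x)"
    using integrable_kernel[OF assms(1,2)] assms(3) by (intro integral_mono) auto
  finally show ?thesis
    by (simp add: prob_space)
qed

lemma pf_Bb:
  assumes "0 \<le> s" "f \<in> Bb"
  shows "pf p s f \<in> Bb"
proof -
  obtain B where "\<And>x. \<bar>f x\<bar> \<le> B" using BbE[OF assms(2)] by metis
  moreover have "pf p s f \<in> borel_measurable borel"
    unfolding pf_def
    by (rule measurable_compose[OF kernel_measurable_fixed_time[OF assms(1)]
          integral_measurable_subprob_algebra[OF Bb_measurable[OF assms(2)]]])
  ultimately show ?thesis
    using pf_abs_le[OF assms] by (intro BbI) auto
qed

lemma pf_nonneg: "(\<And>y. 0 \<le> f y) \<Longrightarrow> 0 \<le> pf p s f x"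
  by (simp add: pf_def)

lemma pf_add_const:
  assumes "0 \<le> s" "f \<in> Bb"
  shows "pf p s (\<lambda>y. f y + c) x = pf p s f x + c"
proof -
  interpret prob_space "p s x" using p_prob[OF assms(1)] by simp
  show ?thesis
    unfolding pf_def using integrable_kernel[OF assms] by (simp add: prob_space)
qed

section \<open>The Markov property for functions and its consequences\<close>

text \<open>Let \<open>?N\<close> be \<open>P x\<close> restricted to \<Lambda>. By
  \<open>P_markov\<close> the law of the path at time \<open>t + s\<close> under \<open>?N\<close>
  is the mixture of the kernels \<open>p s (\<omega> t)\<close>; equality of these two measures
  gives equality of the integrals of \<open>f\<close>.\<close>

lemma markov_nn_integral:
  fixes f :: "'e \<Rightarrow> ennreal"
  assumes "0 \<le> t" "0 \<le> s"
    and f: "f \<in> borel_measurable borel" and \<Lambda>: "\<Lambda> \<in> sets (Fo \<Omega> t)"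
  shows "(\<integral>\<^sup>+\<omega>. f (\<omega> (t + s)) * indicator \<Lambda> \<omega> \<partial>P x)
       = (\<integral>\<^sup>+\<omega>. (\<integral>\<^sup>+y. f y \<partial>p s (\<omega> t)) * indicator \<Lambda> \<omega> \<partial>P x)"
proof -
  have \<Lambda>P[measurable]: "\<Lambda> \<in> sets (P x)"
    using \<Lambda> subalgebra_P_Fo by (auto simp: subalgebra_def)
  have X[measurable]: "(\<lambda>\<omega>. \<omega> (t + s)) \<in> measurable (P x) borel" "(\<lambda>\<omega>. \<omega> t) \<in> measurable (P x) borel"
    using assms by (auto intro: coord_measurable_P)
  note K[measurable] = kernel_measurable_fixed_time[OF assms(2)]
  let ?N = "density (P x) (indicator \<Lambda>)"
  have ne: "space ?N \<noteq> {}"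
    using P_prob[of x] prob_space.not_empty[of "P x"] by simp
  have K': "(\<lambda>\<omega>. p s (\<omega> t)) \<in> measurable ?N (subprob_algebra borel)"
    by measurable
  have law: "distr ?N borel (\<lambda>\<omega>. \<omega> (t + s)) = ?N \<bind> (\<lambda>\<omega>. p s (\<omega> t))"
  proof (rule measure_eqI)
    show "sets (distr ?N borel (\<lambda>\<omega>. \<omega> (t + s))) = sets (?N \<bind> (\<lambda>\<omega>. p s (\<omega> t)))"
      using sets_bind[OF _ ne, of "\<lambda>\<omega>. p s (\<omega> t)" borel] p_prob[OF assms(2)] by simp
    fix A assume "A \<in> sets (distr ?N borel (\<lambda>\<omega>. \<omega> (t + s)))"
    then have A[measurable]: "A \<in> sets borel" by simp
    have "emeasure (distr ?N borel (\<lambda>\<omega>. \<omega> (t + s))) A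
        = (\<integral>\<^sup>+\<omega>. indicator (\<Lambda> \<inter> {\<omega> \<in> \<Omega>. \<omega> (t + s) \<in> A}) \<omega> \<partial>P x)"
      by (subst emeasure_distr, simp, simp, subst emeasure_density, simp, measurable)
         (auto intro!: nn_integral_cong simp: indicator_def)
    also have "\<dots> = emeasure (P x) (\<Lambda> \<inter> {\<omega> \<in> \<Omega>. \<omega> (t + s) \<in> A})"
    proof (rule nn_integral_indicator)
      have "{\<omega> \<in> space (P x). \<omega> (t + s) \<in> A} \<in> sets (P x)"
        by measurable
      then show "\<Lambda> \<inter> {\<omega> \<in> \<Omega>. \<omega> (t + s) \<in> A} \<in> sets (P x)"
        using \<Lambda>P by auto
    qed
    also have "\<dots> = emeasure (?N \<bind> (\<lambda>\<omega>. p s (\<omega> t))) A"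
      unfolding P_markov[OF assms(1,2) A \<Lambda>] emeasure_bind[OF ne K' A]
      by (subst nn_integral_density) (auto simp: mult.commute)
    finally show "emeasure (distr ?N borel (\<lambda>\<omega>. \<omega> (t + s))) A = emeasure (?N \<bind> (\<lambda>\<omega>. p s (\<omega> t))) A" .
  qed
  have "(\<integral>\<^sup>+\<omega>. f (\<omega> (t + s)) * indicator \<Lambda> \<omega> \<partial>P x) = (\<integral>\<^sup>+y. f y \<partial>distr ?N borel (\<lambda>\<omega>. \<omega> (t + s)))"
    using f by (simp add: nn_integral_distr nn_integral_density mult.commute)
  also have "\<dots> = (\<integral>\<^sup>+\<omega>. (\<integral>\<^sup>+y. f y \<partial>p s (\<omega> t)) \<partial>?N)"
    unfolding law by (rule nn_integral_bind[OF f K'])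
  also have "\<dots> = (\<integral>\<^sup>+\<omega>. (\<integral>\<^sup>+y. f y \<partial>p s (\<omega> t)) * indicator \<Lambda> \<omega> \<partial>P x)"
    using f by (subst nn_integral_density) (auto simp: mult.commute)
  finally show ?thesis .
qed

text \<open>With \<Lambda> fixed, the previous lemma says that the densities
  \<open>f (\<omega> (t + s))\<close> and \<open>pf p s f (\<omega> t)\<close> define measures that
  agree on \<open>Fo \<Omega> t\<close>. Hence every nonnegative function \<open>Z\<close>
  measurable for \<open>Fo \<Omega> t\<close> has the same integral under both.\<close>

lemma markov_integral_nonneg:
  assumes "0 \<le> t" "0 \<le> s"
    and Z: "Z \<in> borel_measurable (Fo \<Omega> t)" "\<And>\<omega>. \<omega> \<in> \<Omega> \<Longrightarrow> 0 \<le> Z \<omega>"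
    and f: "f \<in> Bb" "\<And>y. 0 \<le> f y"
  shows "(\<integral>\<omega>. Z \<omega> * f (\<omega> (t + s)) \<partial>P x) = (\<integral>\<omega>. Z \<omega> * pf p s f (\<omega> t) \<partial>P x)"
proof -
  note ZP[measurable] = measurable_P_if_Fo[OF Z(1), of x]
  note fm[measurable] = Bb_measurable[OF f(1)]
  note pfm[measurable] = Bb_measurable[OF pf_Bb[OF assms(2) f(1)]]
  have X[measurable]: "(\<lambda>\<omega>. \<omega> (t + s)) \<in> measurable (P x) borel" "(\<lambda>\<omega>. \<omega> t) \<in> measurable (P x) borel"
    using assms by (auto intro: coord_measurable_P)
  have pf: "(\<integral>\<^sup>+y. ennreal (f y) \<partial>p s z) = ennreal (pf p s f z)" for z
    unfolding pf_def using integrable_kernel[OF assms(2) f(1)] f(2)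
    by (intro nn_integral_eq_integral) auto
  let ?N1 = "density (P x) (\<lambda>\<omega>. ennreal (f (\<omega> (t + s))))"
  let ?N2 = "density (P x) (\<lambda>\<omega>. ennreal (pf p s f (\<omega> t)))"
  have sub1: "subalgebra ?N1 (Fo \<Omega> t)" and sub2: "subalgebra ?N2 (Fo \<Omega> t)"
    using subalgebra_P_Fo[of x t] by (simp_all add: subalgebra_def)
  have "restr_to_subalg ?N1 (Fo \<Omega> t) = restr_to_subalg ?N2 (Fo \<Omega> t)"
  proof (rule measure_eqI)
    show "sets (restr_to_subalg ?N1 (Fo \<Omega> t)) = sets (restr_to_subalg ?N2 (Fo \<Omega> t))"
      using sub1 sub2 by (simp add: sets_restr_to_subalg)
    fix \<Lambda> assume "\<Lambda> \<in> sets (restr_to_subalg ?N1 (Fo \<Omega> t))"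
    then have \<Lambda>: "\<Lambda> \<in> sets (Fo \<Omega> t)"
      using sub1 by (simp add: sets_restr_to_subalg)
    then have [measurable]: "\<Lambda> \<in> sets (P x)"
      using subalgebra_P_Fo[of x t] by (auto simp: subalgebra_def)
    show "emeasure (restr_to_subalg ?N1 (Fo \<Omega> t)) \<Lambda> = emeasure (restr_to_subalg ?N2 (Fo \<Omega> t)) \<Lambda>"
      unfolding emeasure_restr_to_subalg[OF sub1 \<Lambda>] emeasure_restr_to_subalg[OF sub2 \<Lambda>]
      using markov_nn_integral[OF assms(1,2) _ \<Lambda>, of "\<lambda>y. ennreal (f y)" x]
      by (simp add: emeasure_density pf)
  qed
  then have "(\<integral>\<^sup>+\<omega>. ennreal (Z \<omega>) \<partial>?N1) = (\<integral>\<^sup>+\<omega>. ennreal (Z \<omega>) \<partial>?N2)"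
    using nn_integral_subalgebra2[OF sub1, of "\<lambda>\<omega>. ennreal (Z \<omega>)"]
      nn_integral_subalgebra2[OF sub2, of "\<lambda>\<omega>. ennreal (Z \<omega>)"] Z(1) by simp
  then have "(\<integral>\<^sup>+\<omega>. ennreal (Z \<omega> * f (\<omega> (t + s))) \<partial>P x) = (\<integral>\<^sup>+\<omega>. ennreal (Z \<omega> * pf p s f (\<omega> t)) \<partial>P x)"
    by (simp add: nn_integral_density ennreal_mult'' f(2) pf_nonneg mult.commute)
  moreover have "AE \<omega> in P x. 0 \<le> Z \<omega> * f (\<omega> (t + s))" "AE \<omega> in P x. 0 \<le> Z \<omega> * pf p s f (\<omega> t)"
    using Z(2) f(2) pf_nonneg by (auto intro!: AE_I2)
  ultimately show ?thesis
    by (simp add: integral_eq_nn_integral)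
qed

lemma integrable_P_bounded:
  fixes Z :: "(real \<Rightarrow> 'e) \<Rightarrow> real"
  assumes "Z \<in> borel_measurable (P x)" "\<And>\<omega>. \<omega> \<in> \<Omega> \<Longrightarrow> \<bar>Z \<omega>\<bar> \<le> C"
  shows "integrable (P x) Z"
proof -
  interpret prob_space "P x" using P_prob by simp
  show ?thesis
    using assms by (intro integrable_const_bound[where B = C]) (auto intro!: AE_I2)
qed

lemma abs_expectation_le:
  fixes Z :: "(real \<Rightarrow> 'e) \<Rightarrow> real"
  assumes "\<And>\<omega>. \<omega> \<in> \<Omega> \<Longrightarrow> \<bar>Z \<omega>\<bar> \<le> C"
  shows "\<bar>\<integral>\<omega>. Z \<omega> \<partial>P x\<bar> \<le> C"
proof -
  interpret prob_space "P x" using P_prob by simp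
  \<comment> \<open>\<Omega> is nonempty, so \<open>C\<close> dominates some absolute value. The
    sign matters because a nonintegrable \<open>Z\<close> has integral \<open>0\<close> by
    convention.\<close>
  have "C \<ge> 0"
    using assms not_empty by fastforce
  have "\<bar>\<integral>\<omega>. Z \<omega> \<partial>P x\<bar> \<le> (\<integral>\<omega>. \<bar>Z \<omega>\<bar> \<partial>P x)"
    by (rule integral_abs_bound)
  also have "\<dots> \<le> (\<integral>\<omega>. C \<partial>P x)"
    using assms \<open>C \<ge> 0\<close> by (intro integral_mono_AE') (auto intro!: AE_I2)
  finally show ?thesis
    by simp
qed

text \<open>Adding the bounds \<open>C\<close> to \<open>Z\<close> and \<open>B\<close> to
  \<open>f\<close> reduces the claim to the nonnegative case.\<close>

lemma markov_integral:
  assumes ts: "0 \<le> t" "0 \<le> s"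
    and Z: "Z \<in> borel_measurable (Fo \<Omega> t)" "\<And>\<omega>. \<omega> \<in> \<Omega> \<Longrightarrow> \<bar>Z \<omega>\<bar> \<le> C"
    and f: "f \<in> Bb"
  shows "(\<integral>\<omega>. Z \<omega> * f (\<omega> (t + s)) \<partial>P x) = (\<integral>\<omega>. Z \<omega> * pf p s f (\<omega> t) \<partial>P x)"
proof -
  obtain B where B: "B \<ge> 0" "\<And>x. \<bar>f x\<bar> \<le> B" using BbE[OF f] by metis
  interpret prob_space "P x" using P_prob by simp
  note ZP[measurable] = measurable_P_if_Fo[OF Z(1), of x]
  note fm[measurable] = Bb_measurable[OF f]
  note pfm[measurable] = Bb_measurable[OF pf_Bb[OF ts(2) f]]
  have X[measurable]: "(\<lambda>\<omega>. \<omega> (t + s)) \<in> measurable (P x) borel" "(\<lambda>\<omega>. \<omega> t) \<in> measurable (P x) borel"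
    using ts by (auto intro: coord_measurable_P)
  let ?f = "\<lambda>y. f y + B"
  have f0: "0 \<le> ?f y" "\<bar>?f y\<bar> \<le> B + B" for y
    using B(1) B(2)[of y] by linarith+
  have f': "?f \<in> Bb" "\<And>y. 0 \<le> ?f y"
    using f0 by (auto intro!: BbI[where B = "B + B"])
  have pf': "pf p s ?f y = pf p s f y + B" for y
    by (rule pf_add_const[OF ts(2) f])
  \<comment> \<open>Of the three terms, the first two are compared by the nonnegative Markov
    property, with weights \<open>Z + C\<close> and \<open>1\<close>; the third does not depend on
    \<open>G\<close> and is common to both sides.\<close>
  have expand: "(\<integral>\<omega>. Z \<omega> * G \<omega> \<partial>P x) = (\<integral>\<omega>. (Z \<omega> + C) * (G \<omega> + B) \<partial>P x)
      - C * (\<integral>\<omega>. 1 * (G \<omega> + B) \<partial>P x) - B * (\<integral>\<omega>. Z \<omega> \<partial>P x)"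
    if [measurable]: "G \<in> borel_measurable (P x)" and G: "\<And>\<omega>. \<bar>G \<omega>\<bar> \<le> B" for G
  proof -
    have int: "integrable (P x) G" "integrable (P x) Z"
      using integrable_P_bounded[of G x B] integrable_P_bounded[of Z x C] G Z(2) by auto
    have "integrable (P x) (\<lambda>\<omega>. Z \<omega> * G \<omega>)"
      using G Z(2) B(1) by (intro integrable_P_bounded[where C = "C * B"])
        (auto simp: abs_mult intro!: mult_mono order_trans[OF abs_ge_zero])
    then show ?thesis
      using int by (simp add: algebra_simps prob_space)
  qed
  have "(\<integral>\<omega>. (Z \<omega> + C) * ?f (\<omega> (t + s)) \<partial>P x) = (\<integral>\<omega>. (Z \<omega> + C) * pf p s ?f (\<omega> t) \<partial>P x)"
    using Z(1) Z(2) by (intro markov_integral_nonneg ts f') (auto simp: abs_le_iff, smt (verit))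
  moreover have "(\<integral>\<omega>. 1 * ?f (\<omega> (t + s)) \<partial>P x) = (\<integral>\<omega>. 1 * pf p s ?f (\<omega> t) \<partial>P x)"
    by (intro markov_integral_nonneg ts f') auto
  ultimately show ?thesis
    using expand[of "\<lambda>\<omega>. f (\<omega> (t + s))"] expand[of "\<lambda>\<omega>. pf p s f (\<omega> t)"]
      B(2) pf_abs_le[OF ts(2) f B(2)] by (simp add: pf')
qed

lemma start_integral:
  assumes "f \<in> borel_measurable borel"
  shows "(\<integral>\<omega>. f (\<omega> 0) \<partial>P x) = (f x :: real)"
proof -
  interpret prob_space "P x" using P_prob by simp
  \<comment> \<open>The event is measurable: a set outside the sigma-algebra would have
    \<open>emeasure\<close> equal to \<open>0\<close>, while \<open>P_start\<close> gives
    \<open>1\<close>.\<close>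
  have "AE \<omega> in P x. \<omega> \<in> {\<omega> \<in> \<Omega>. \<omega> 0 = x}"
    using P_start[of x] emeasure_notin_sets[of "{\<omega> \<in> \<Omega>. \<omega> 0 = x}" "P x"]
    by (intro AE_in_set_eq_1[THEN iffD2]) (fastforce simp: measure_def)+
  then have "AE \<omega> in P x. f (\<omega> 0) = f x"
    by (rule eventually_mono) auto
  then have "(\<integral>\<omega>. f (\<omega> 0) \<partial>P x) = (\<integral>\<omega>. f x \<partial>P x)"
    using assms coord_measurable_P[of 0 x]
    by (intro integral_cong_AE) auto
  then show ?thesis
    by (simp add: prob_space)
qed

lemma expectation_coord:
  assumes "0 \<le> s" "f \<in> Bb"
  shows "(\<integral>\<omega>. f (\<omega> s) \<partial>P x) = pf p s f x"
  using markov_integral[of 0 s "\<lambda>_. 1" 1 f x] assms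
    start_integral[OF Bb_measurable[OF pf_Bb[OF assms]], of x] by simp

text \<open>The semigroup law is derived from the process: the expectation of
  \<open>f (\<omega> (s + r))\<close> is computed directly and by conditioning at time
  \<open>s\<close>.\<close>

lemma chapman_kolmogorov:
  assumes "0 \<le> s" "0 \<le> r" "f \<in> Bb"
  shows "pf p (s + r) f x = pf p s (pf p r f) x"
  using markov_integral[of s r "\<lambda>_. 1" 1 f x] assms
    expectation_coord[of "s + r" f x] expectation_coord[of s "pf p r f" x] pf_Bb[of r f] by simp

lemma pf_set_integrable:
  assumes "f \<in> Bb"
  shows "set_integrable lborel {0..c} (\<lambda>s. pf p s f x)"
proof -
  obtain B where "\<And>x. \<bar>f x\<bar> \<le> B" using BbE[OF assms] by metis
  moreover have "(\<lambda>s. pf p (max 0 s) f x) \<in> borel_measurable borel"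
    using measurable_compose[OF measurable_Pair2' pf_measurable_joint[OF Bb_measurable[OF assms]], of x]
    by simp
  ultimately show ?thesis
    using pf_abs_le[OF _ assms]
    by (intro set_integrable_interval_bounded[of "\<lambda>s. pf p (max 0 s) f x" _ _ _ B]) auto
qed

section \<open>The time averages \<open>vrep\<close> and the Dynkin formula\<close>

lemma vrep_Bb:
  assumes "u \<in> Bb" "0 < t" "0 \<le> \<eta>"
  shows "vrep p u t \<eta> \<in> Bb"
proof -
  have U: "pf p \<eta> u \<in> Bb" using pf_Bb assms by auto
  obtain B where B: "\<And>x. \<bar>pf p \<eta> u x\<bar> \<le> B" using BbE[OF U] by metis
  show ?thesis
  proof (rule BbI)
    show "vrep p u t \<eta> \<in> borel_measurable borel"
      unfolding vrep_def
      by (intro borel_measurable_times borel_measurable_const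
          set_integral_measurable_parameter[OF pf_measurable_joint[OF Bb_measurable[OF U]]]) auto
    fix x
    have "\<bar>LINT s:{0..t}|lborel. pf p s (pf p \<eta> u) x\<bar> \<le> B * (t - 0)"
      using assms by (intro set_integral_interval_bound pf_set_integrable U pf_abs_le[OF _ U B]) auto
    then show "\<bar>vrep p u t \<eta> x\<bar> \<le> B"
      using assms by (simp add: vrep_def abs_mult divide_le_eq)
  qed
qed

lemma Lhat_rep_Bb:
  assumes "u \<in> Bb" "0 < t" "0 \<le> \<eta>"
  shows "Lhat_rep p u t \<eta> \<in> Bb"
proof -
  have U: "pf p \<eta> u \<in> Bb" using pf_Bb assms by auto
  obtain B where B: "\<And>x. \<bar>pf p \<eta> u x\<bar> \<le> B" using BbE[OF U] by metis
  have pU: "pf p t (pf p \<eta> u) \<in> Bb" using pf_Bb U assms by auto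
  show ?thesis
  proof (rule BbI)
    show "Lhat_rep p u t \<eta> \<in> borel_measurable borel"
      unfolding Lhat_rep_def using Bb_measurable[OF U] Bb_measurable[OF pU] by measurable
    fix x
    have "\<bar>pf p t (pf p \<eta> u) x - pf p \<eta> u x\<bar> \<le> B + B"
      using pf_abs_le[OF _ U B, of t x] B[of x] assms by linarith
    then have "1 / t * \<bar>pf p t (pf p \<eta> u) x - pf p \<eta> u x\<bar> \<le> 1 / t * (B + B)"
      using assms by (intro mult_left_mono) auto
    then show "\<bar>Lhat_rep p u t \<eta> x\<bar> \<le> 1 / t * (B + B)"
      using assms by (simp add: Lhat_rep_def abs_mult)
  qed
qed

lemma vrep_nonneg:
  assumes "\<And>x. 0 \<le> u x" "0 < t"
  shows "0 \<le> vrep p u t \<eta> x"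
  using assms unfolding vrep_def set_lebesgue_integral_def
  by (intro mult_nonneg_nonneg integral_nonneg_AE AE_I2) (auto simp: pf_nonneg)

text \<open>\<open>Lhat_rep\<close> acts as the generator on \<open>vrep\<close>. Applying
  \<open>p r\<close> to the time average moves the averaging window from \<open>{0..t}\<close> to
  \<open>{r..r + t}\<close>; the gain at its right end minus the loss at its left end is the
  integral of \<open>pf p s (Lhat_rep p u t \<eta>) x\<close> over \<open>{0..r}\<close>.\<close>

lemma dynkin_vrep:
  assumes u: "u \<in> Bb" and t: "0 < t" and \<eta>: "0 \<le> \<eta>" and r: "0 \<le> r"
  shows "pf p r (vrep p u t \<eta>) x
       = vrep p u t \<eta> x + (LINT s:{0..r}|lborel. pf p s (Lhat_rep p u t \<eta>) x)"
proof -
  define U where "U = pf p \<eta> u"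
  have U: "U \<in> Bb" using pf_Bb u \<eta> by (auto simp: U_def)
  obtain B where B: "\<And>x. \<bar>U x\<bar> \<le> B" using BbE[OF U] by metis
  \<comment> \<open>\<open>H\<close> is the orbit of \<open>U\<close> seen from the fixed point
    \<open>x\<close>; after Fubini and Chapman-Kolmogorov only one-dimensional integrals of
    \<open>H\<close> remain.\<close>
  define H where "H s = pf p s U x" for s
  have H_int: "set_integrable lborel {0..c} H" for c
    unfolding H_def by (rule pf_set_integrable[OF U])
  have prx: "prob_space (p r x)" "sets (p r x) = sets borel" using p_prob r by auto
  have "pf p r (vrep p u t \<eta>) x = 1 / t * (\<integral>y. (LINT s:{0..t}|lborel. pf p s U y) \<partial>p r x)"
    unfolding pf_def[of p r "vrep p u t \<eta>"] vrep_def U_def by simp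
  also have "(\<integral>y. (LINT s:{0..t}|lborel. pf p s U y) \<partial>p r x)
      = (LINT s:{0..t}|lborel. (\<integral>y. pf p s U y \<partial>p r x))"
    using pf_measurable_joint[OF Bb_measurable[OF U]] prx(2) pf_abs_le[OF _ U B]
    by (intro set_integral_Fubini_bounded(1)[OF prx(1), of "\<lambda>z. pf p (max 0 (fst z)) U (snd z)"])
       (auto cong: measurable_cong_sets sets_pair_measure_cong)
  also have "\<dots> = (LINT s:{0..t}|lborel. H (r + s))"
    unfolding H_def using chapman_kolmogorov[OF r _ U]
    by (intro set_lebesgue_integral_cong) (auto simp: pf_def[of p r])
  \<comment> \<open>The integral of \<open>H\<close> over \<open>{0..r + t}\<close> is split once at
    \<open>r\<close> and once at \<open>t\<close>, and the two results are equated.\<close>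
  also have "\<dots> = (LINT s:{0..t}|lborel. H s) + (LINT s:{0..r}|lborel. H (t + s)) - (LINT s:{0..r}|lborel. H s)"
    using set_integral_interval_split_shift(1)[OF H_int, of r t]
      set_integral_interval_split_shift(1)[OF H_int, of t r] t r by (simp add: add.commute)
  also have "1 / t * \<dots> = vrep p u t \<eta> x + 1 / t * ((LINT s:{0..r}|lborel. H (t + s)) - (LINT s:{0..r}|lborel. H s))"
    by (simp add: vrep_def U_def[symmetric] H_def algebra_simps)
  also have "(LINT s:{0..r}|lborel. H (t + s)) - (LINT s:{0..r}|lborel. H s)
      = (LINT s:{0..r}|lborel. H (t + s) - H s)"
    using t r by (intro set_integral_diff(2)[symmetric] H_int set_integral_interval_split_shift(2)) auto
  also have "1 / t * \<dots> = (LINT s:{0..r}|lborel. 1 / t * (H (t + s) - H s))"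
    by simp
  also have "\<dots> = (LINT s:{0..r}|lborel. pf p s (Lhat_rep p u t \<eta>) x)"
  proof (intro set_lebesgue_integral_cong allI impI)
    fix s assume s: "s \<in> {0..r}"
    have "pf p s (Lhat_rep p u t \<eta>) x = 1 / t * (pf p s (pf p t U) x - pf p s U x)"
      using integrable_kernel[of s "pf p t U" x] integrable_kernel[of s U x] pf_Bb[OF _ U, of t] U s t
      unfolding pf_def[of p s] Lhat_rep_def U_def[symmetric] by simp
    also have "pf p s (pf p t U) x = H (t + s)"
      using chapman_kolmogorov[of s t U x] s t U by (simp add: H_def add.commute)
    finally show "1 / t * (H (t + s) - H s) = pf p s (Lhat_rep p u t \<eta>) x"
      by (simp add: H_def)
  qed simp
  finally show ?thesis .
qed

section \<open>The Feynman-Kac identity\<close>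

lemma path_int_measurable:
  assumes "V \<in> borel_measurable borel" "0 \<le> t"
  shows "path_int V t \<in> borel_measurable (Fo \<Omega> t)"
  unfolding path_int_def
  by (rule set_integral_measurable_parameter[OF
        measurable_compose[OF path_measurable_Fo[OF assms(2)] assms(1)]]) auto

lemma path_set_integrable:
  assumes V: "V \<in> Bb" and "0 \<le> T" "\<omega> \<in> \<Omega>"
  shows "set_integrable lborel {0..T} (\<lambda>s. V (\<omega> s))"
proof -
  obtain B where "\<And>x. \<bar>V x\<bar> \<le> B" using BbE[OF V] by metis
  moreover have "(\<lambda>s. V (\<omega> (max 0 (min T s)))) \<in> borel_measurable borel"
    using measurable_compose[OF measurable_Pair2'
        measurable_compose[OF path_measurable_Fo[OF assms(2)] Bb_measurable[OF V]], of \<omega>] assms(3)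
    by simp
  ultimately show ?thesis
    by (intro set_integrable_interval_bounded[of "\<lambda>s. V (\<omega> (max 0 (min T s)))" _ _ _ B]) auto
qed

lemma path_int_abs_le:
  assumes "V \<in> Bb" "0 \<le> t" "\<omega> \<in> \<Omega>" "\<And>x. \<bar>V x\<bar> \<le> B"
  shows "\<bar>path_int V t \<omega>\<bar> \<le> B * t"
  using set_integral_interval_bound[OF path_set_integrable[OF assms(1-3)] assms(2), of B] assms(4)
  by (simp add: path_int_def)

text \<open>Over \<open>[t, t + h]\<close> the weight changes by the factor
  \<open>exp (- D)\<close>, with \<open>D\<close> of order \<open>h\<close>. Expanding it to first
  order leaves a remainder of order \<open>h\<^sup>2\<close>. The growth of \<open>w\<close> along
  the path and the term linear in \<open>D\<close> contribute the integrals of \<open>J\<close> and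
  \<open>N\<close> over \<open>{0..h}\<close>, and these integrands differ by order \<open>h\<close>
  only.\<close>

lemma feynman_kac_increment:
  fixes w g V :: "'e \<Rightarrow> real"
  assumes w: "w \<in> Bb" "\<And>x. \<bar>w x\<bar> \<le> K" and g: "g \<in> Bb" "\<And>x. \<bar>g x\<bar> \<le> G"
    and V: "V \<in> Bb" "\<And>x. \<bar>V x\<bar> \<le> B" and gV: "\<And>x. V x * w x = g x"
    and dyn: "\<And>s x. 0 \<le> s \<Longrightarrow> pf p s w x = w x + (LINT r:{0..s}|lborel. pf p r g x)"
    and t: "0 \<le> t" and h: "0 \<le> h" and Bh: "B * h \<le> 1"
  defines "M \<equiv> (\<lambda>t \<omega>. w (\<omega> t) * exp (- path_int V t \<omega>))"
  shows "\<bar>(\<integral>\<omega>. M (t + h) \<omega> \<partial>P x) - (\<integral>\<omega>. M t \<omega> \<partial>P x)\<bar> \<le> exp (B * t) * (B * G + K * B\<^sup>2) * h\<^sup>2"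
proof -
  interpret prob_space "P x" using P_prob by simp
  have B0: "0 \<le> B" and G0: "0 \<le> G" and K0: "0 \<le> K"
    using V(2) g(2) w(2) by (meson abs_ge_zero order_trans)+
  have th: "0 \<le> t + h" using t h by simp
  note [measurable] = Bb_measurable[OF w(1)] Bb_measurable[OF g(1)] Bb_measurable[OF V(1)]
  note X[measurable] = coord_measurable_P[OF t] coord_measurable_P[OF th]
  define Z where "Z \<omega> = exp (- path_int V t \<omega>)" for \<omega>
  define C where "C = exp (B * t)"
  have ZF[measurable]: "Z \<in> borel_measurable (Fo \<Omega> t)"
    unfolding Z_def using path_int_measurable[OF Bb_measurable[OF V(1)] t] by measurable
  note ZP[measurable] = measurable_P_if_Fo[OF ZF, of x]
  have Zb: "\<bar>Z \<omega>\<bar> \<le> C" if "\<omega> \<in> \<Omega>" for \<omega>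
    using path_int_abs_le[OF V(1) t that V(2)] by (simp add: Z_def C_def)
  have C0: "0 \<le> C" by (simp add: C_def)
  define D where "D \<omega> = (LINT r:{0..h}|lborel. V (\<omega> (t + r)))" for \<omega>
  have path_add: "path_int V (t + h) \<omega> = path_int V t \<omega> + D \<omega>" if "\<omega> \<in> \<Omega>" for \<omega>
    unfolding path_int_def D_def
    using set_integral_interval_split_shift(1)[OF path_set_integrable[OF V(1) th that] t h] .
  have Db: "\<bar>D \<omega>\<bar> \<le> B * h" if "\<omega> \<in> \<Omega>" for \<omega>
    unfolding D_def
    using set_integral_interval_bound[OF
        set_integral_interval_split_shift(2)[OF path_set_integrable[OF V(1) th that] t h] h, of B] V(2)
    by simp
  note path = path_measurable_P[OF th, of x]
  \<comment> \<open>The clamp is invisible for shifts in \<open>{0..h}\<close>, the only ones that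
    enter the integrals.\<close>
  have shift: "(\<lambda>z. snd z (max 0 (min (t + h) (t + fst z)))) \<in> measurable (borel \<Otimes>\<^sub>M P x) borel"
    using measurable_compose[OF _ path, of "\<lambda>z. (t + fst z, snd z)" "borel \<Otimes>\<^sub>M P x"] by simp
  have Dm[measurable]: "D \<in> borel_measurable (P x)"
    unfolding D_def using t
    by (intro set_integral_measurable_parameter[OF measurable_compose[OF shift Bb_measurable[OF V(1)]]]) auto

  have Mt: "(\<integral>\<omega>. M t \<omega> \<partial>P x) = (\<integral>\<omega>. Z \<omega> * w (\<omega> t) \<partial>P x)"
    by (simp add: M_def Z_def mult.commute)

  \<comment> \<open>\<open>J\<close> is the rate at which \<open>w\<close> changes along the path in
    expectation, \<open>N\<close> the rate coming from the exponential weight, with \<open>w\<close>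
    still evaluated at the end time \<open>t + h\<close>.\<close>
  define J where "J r = (\<integral>\<omega>. Z \<omega> * g (\<omega> (t + r)) \<partial>P x)" for r
  define N where "N r = (\<integral>\<omega>. Z \<omega> * V (\<omega> (t + r)) * w (\<omega> (t + h)) \<partial>P x)" for r

  have int_Zw: "integrable (P x) (\<lambda>\<omega>. Z \<omega> * w (\<omega> t))" "integrable (P x) (\<lambda>\<omega>. Z \<omega> * w (\<omega> (t + h)))"
    using Zb w(2) C0 by (auto simp: abs_mult intro!: integrable_P_bounded[where C = "C * K"] mult_mono)

  \<comment> \<open>Conditioning at \<open>t\<close> replaces \<open>w (\<omega> (t + h))\<close> by
    \<open>pf p h w (\<omega> t)\<close>, which \<open>dyn\<close> expands. After Fubini, the Markov
    property used backwards turns \<open>pf p r g (\<omega> t)\<close> into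
    \<open>g (\<omega> (t + r))\<close>.\<close>
  have first: "(\<integral>\<omega>. Z \<omega> * w (\<omega> (t + h)) \<partial>P x)
      = (\<integral>\<omega>. Z \<omega> * w (\<omega> t) \<partial>P x) + (LINT r:{0..h}|lborel. J r)"
    and J_int: "set_integrable lborel {0..h} J"
  proof -
    let ?k = "\<lambda>r \<omega>. Z \<omega> * pf p r g (\<omega> t)"
    let ?k' = "\<lambda>z. Z (snd z) * pf p (max 0 (fst z)) g (snd z t)"
    have m: "?k' \<in> borel_measurable (borel \<Otimes>\<^sub>M P x)"
      using measurable_compose[OF _ pf_measurable_joint[OF Bb_measurable[OF g(1)]],
          of "\<lambda>z. (fst z, snd z t)" "borel \<Otimes>\<^sub>M P x"] by simp
    have b: "\<bar>?k r \<omega>\<bar> \<le> C * G" if "r \<in> {0..h}" "\<omega> \<in> space (P x)" for r \<omega>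
      using Zb pf_abs_le[OF _ g] that C0 by (auto simp: abs_mult intro!: mult_mono)
    have J: "(\<integral>\<omega>. ?k r \<omega> \<partial>P x) = J r" if "r \<in> {0..h}" for r
      unfolding J_def using markov_integral[OF t _ ZF Zb g(1), of r x] that by simp
    have e: "?k r \<omega> = ?k' (r, \<omega>)" if "r \<in> {0..h}" for r \<omega>
      using that by simp
    have F: "(\<integral>\<omega>. (LINT r:{0..h}|lborel. ?k r \<omega>) \<partial>P x) = (LINT r:{0..h}|lborel. (\<integral>\<omega>. ?k r \<omega> \<partial>P x))"
        "set_integrable lborel {0..h} (\<lambda>r. \<integral>\<omega>. ?k r \<omega> \<partial>P x)"
        "integrable (P x) (\<lambda>\<omega>. LINT r:{0..h}|lborel. ?k r \<omega>)"
      by (rule set_integral_Fubini_bounded[OF prob_space_axioms m e b]; assumption)+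
    have "(\<integral>\<omega>. Z \<omega> * w (\<omega> (t + h)) \<partial>P x) = (\<integral>\<omega>. Z \<omega> * pf p h w (\<omega> t) \<partial>P x)"
      by (rule markov_integral[OF t h ZF Zb w(1)])
    also have "\<dots> = (\<integral>\<omega>. Z \<omega> * w (\<omega> t) + (LINT r:{0..h}|lborel. ?k r \<omega>) \<partial>P x)"
      by (simp add: dyn[OF h] algebra_simps)
    also have "\<dots> = (\<integral>\<omega>. Z \<omega> * w (\<omega> t) \<partial>P x) + (\<integral>\<omega>. (LINT r:{0..h}|lborel. ?k r \<omega>) \<partial>P x)"
      by (intro Bochner_Integration.integral_add int_Zw F)
    also have "(\<integral>\<omega>. (LINT r:{0..h}|lborel. ?k r \<omega>) \<partial>P x) = (LINT r:{0..h}|lborel. J r)"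
      unfolding F(1) using J by (intro set_lebesgue_integral_cong) auto
    finally show "(\<integral>\<omega>. Z \<omega> * w (\<omega> (t + h)) \<partial>P x)
      = (\<integral>\<omega>. Z \<omega> * w (\<omega> t) \<partial>P x) + (LINT r:{0..h}|lborel. J r)" .
    show "set_integrable lborel {0..h} J"
      using F(2) J by (subst set_integrable_cong[OF refl refl, of _ J]) auto
  qed

  have second: "(\<integral>\<omega>. Z \<omega> * w (\<omega> (t + h)) * D \<omega> \<partial>P x) = (LINT r:{0..h}|lborel. N r)"
    and N_int: "set_integrable lborel {0..h} N"
  proof -
    let ?k = "\<lambda>r \<omega>. Z \<omega> * V (\<omega> (t + r)) * w (\<omega> (t + h))"
    let ?k' = "\<lambda>z. Z (snd z) * V (snd z (max 0 (min (t + h) (t + fst z)))) * w (snd z (t + h))"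
    have m: "?k' \<in> borel_measurable (borel \<Otimes>\<^sub>M P x)"
      using measurable_compose[OF shift Bb_measurable[OF V(1)]] by measurable
    have b: "\<bar>?k r \<omega>\<bar> \<le> C * B * K" if "r \<in> {0..h}" "\<omega> \<in> space (P x)" for r \<omega>
      using Zb V(2) w(2) that C0 B0 by (auto simp: abs_mult intro!: mult_mono)
    have e: "?k r \<omega> = ?k' (r, \<omega>)" if "r \<in> {0..h}" for r \<omega>
      using that t by simp
    have F: "(\<integral>\<omega>. (LINT r:{0..h}|lborel. ?k r \<omega>) \<partial>P x) = (LINT r:{0..h}|lborel. (\<integral>\<omega>. ?k r \<omega> \<partial>P x))"
        "set_integrable lborel {0..h} (\<lambda>r. \<integral>\<omega>. ?k r \<omega> \<partial>P x)"
        "integrable (P x) (\<lambda>\<omega>. LINT r:{0..h}|lborel. ?k r \<omega>)"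
      by (rule set_integral_Fubini_bounded[OF prob_space_axioms m e b]; assumption)+
    have "(\<integral>\<omega>. Z \<omega> * w (\<omega> (t + h)) * D \<omega> \<partial>P x) = (\<integral>\<omega>. (LINT r:{0..h}|lborel. ?k r \<omega>) \<partial>P x)"
      unfolding D_def by (simp add: ac_simps flip: set_integral_mult_right)
    also have "\<dots> = (LINT r:{0..h}|lborel. N r)"
      unfolding N_def by (rule F(1))
    finally show "(\<integral>\<omega>. Z \<omega> * w (\<omega> (t + h)) * D \<omega> \<partial>P x) = (LINT r:{0..h}|lborel. N r)" .
    show "set_integrable lborel {0..h} N"
      unfolding N_def by (rule F(2))
  qed

  \<comment> \<open>The first-order terms cancel by the Markov property at time \<open>t + r\<close> and \<open>V w = g\<close>,
    up to replacing \<open>p\<^bsub>h - r\<^esub> w\<close> by \<open>w\<close>.\<close>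
  have JN: "\<bar>J r - N r\<bar> \<le> C * B * G * h" if r: "r \<in> {0..h}" for r
  proof -
    have tr: "0 \<le> t + r" "t \<le> t + r" and hr: "0 \<le> h - r" using r t by auto
    note [measurable] = coord_measurable_P[OF tr(1), of x] Bb_measurable[OF pf_Bb[OF hr w(1)]]
    have ZV: "(\<lambda>\<omega>. Z \<omega> * V (\<omega> (t + r))) \<in> borel_measurable (Fo \<Omega> (t + r))"
    proof -
      have "Z \<in> borel_measurable (Fo \<Omega> (t + r))"
        by (rule measurable_from_subalg[OF subalgebra_Fo_mono[OF tr(2)] ZF])
      moreover have "(\<lambda>\<omega>. V (\<omega> (t + r))) \<in> borel_measurable (Fo \<Omega> (t + r))"
        using coord_measurable_Fo[OF tr(1) order_refl] Bb_measurable[OF V(1)]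
        by (rule measurable_compose)
      ultimately show ?thesis by measurable
    qed
    have ZVb: "\<bar>Z \<omega> * V (\<omega> (t + r))\<bar> \<le> C * B" if "\<omega> \<in> \<Omega>" for \<omega>
      using Zb V(2) that C0 by (auto simp: abs_mult intro!: mult_mono)
    have "N r = (\<integral>\<omega>. Z \<omega> * V (\<omega> (t + r)) * pf p (h - r) w (\<omega> (t + r)) \<partial>P x)"
      using markov_integral[OF tr(1) hr ZV ZVb w(1)] by (simp add: N_def)
    moreover have "J r = (\<integral>\<omega>. Z \<omega> * V (\<omega> (t + r)) * w (\<omega> (t + r)) \<partial>P x)"
      by (simp add: J_def mult.assoc gV)
    moreover have "integrable (P x) (\<lambda>\<omega>. Z \<omega> * V (\<omega> (t + r)) * pf p (h - r) w (\<omega> (t + r)))"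
      "integrable (P x) (\<lambda>\<omega>. Z \<omega> * V (\<omega> (t + r)) * w (\<omega> (t + r)))"
      using Zb V(2) w(2) pf_abs_le[OF hr w] C0 B0
      by (auto simp: abs_mult intro!: integrable_P_bounded[where C = "C * B * K"] mult_mono)
    ultimately have "J r - N r
        = (\<integral>\<omega>. Z \<omega> * V (\<omega> (t + r)) * (w (\<omega> (t + r)) - pf p (h - r) w (\<omega> (t + r))) \<partial>P x)"
      by (simp add: algebra_simps)
    also have "\<bar>\<dots>\<bar> \<le> C * B * G * h"
    proof (rule abs_expectation_le)
      fix \<omega> assume "\<omega> \<in> \<Omega>"
      have "\<bar>LINT s:{0..h - r}|lborel. pf p s g (\<omega> (t + r))\<bar> \<le> G * (h - r - 0)"
        using hr g by (intro set_integral_interval_bound pf_set_integrable pf_abs_le) auto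
      also have "\<dots> \<le> G * h"
        using r G0 by (intro mult_left_mono) auto
      finally have "\<bar>w (\<omega> (t + r)) - pf p (h - r) w (\<omega> (t + r))\<bar> \<le> G * h"
        by (simp add: dyn[OF hr])
      then have "\<bar>Z \<omega> * V (\<omega> (t + r))\<bar> * \<bar>w (\<omega> (t + r)) - pf p (h - r) w (\<omega> (t + r))\<bar> \<le> (C * B) * (G * h)"
        using ZVb[OF \<open>\<omega> \<in> \<Omega>\<close>] C0 B0 by (intro mult_mono) auto
      then show "\<bar>Z \<omega> * V (\<omega> (t + r)) * (w (\<omega> (t + r)) - pf p (h - r) w (\<omega> (t + r)))\<bar> \<le> C * B * G * h"
        by (simp add: abs_mult mult.assoc)
    qed
    finally show ?thesis .
  qed

  \<comment> \<open>The assumption \<open>Bh\<close> gives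
    \<open>\<bar>D \<omega>\<bar> \<le> 1\<close>, the range in which
    \<open>exp_remainder_abs_le\<close> applies.\<close>
  let ?R = "\<lambda>\<omega>. Z \<omega> * w (\<omega> (t + h)) * (exp (- D \<omega>) - 1 - (- D \<omega>))"
  have Rb: "\<bar>?R \<omega>\<bar> \<le> C * K * (B * h)\<^sup>2" if "\<omega> \<in> \<Omega>" for \<omega>
  proof -
    have "\<bar>exp (- D \<omega>) - 1 - (- D \<omega>)\<bar> \<le> (- D \<omega>)\<^sup>2"
      using Db[OF that] Bh by (intro exp_remainder_abs_le) simp
    also have "\<dots> \<le> (B * h)\<^sup>2"
      using Db[OF that] power_mono[of "\<bar>D \<omega>\<bar>" "B * h" 2] by simp
    finally show ?thesis
      using Zb[OF that] w(2)[of "\<omega> (t + h)"] C0 K0 by (auto simp: abs_mult intro!: mult_mono)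
  qed
  have int_ZwD: "integrable (P x) (\<lambda>\<omega>. Z \<omega> * w (\<omega> (t + h)) * D \<omega>)"
    using Zb w(2) Db C0 K0 by (auto simp: abs_mult intro!: integrable_P_bounded[where C = "C * K * (B * h)"] mult_mono)
  have int_R: "integrable (P x) ?R"
    using Rb by (intro integrable_P_bounded[where C = "C * K * (B * h)\<^sup>2"]) auto
  have "(\<integral>\<omega>. M (t + h) \<omega> \<partial>P x)
      = (\<integral>\<omega>. Z \<omega> * w (\<omega> (t + h)) - Z \<omega> * w (\<omega> (t + h)) * D \<omega> + ?R \<omega> \<partial>P x)"
    by (intro Bochner_Integration.integral_cong refl, simp only: M_def Z_def space_P path_add)
       (simp add: exp_diff exp_minus field_simps)
  also have "\<dots> = (\<integral>\<omega>. Z \<omega> * w (\<omega> (t + h)) \<partial>P x) - (\<integral>\<omega>. Z \<omega> * w (\<omega> (t + h)) * D \<omega> \<partial>P x) + (\<integral>\<omega>. ?R \<omega> \<partial>P x)"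
    using int_Zw int_ZwD int_R by (simp only: Bochner_Integration.integral_add Bochner_Integration.integral_diff
        Bochner_Integration.integrable_diff)
  finally have "(\<integral>\<omega>. M (t + h) \<omega> \<partial>P x) - (\<integral>\<omega>. M t \<omega> \<partial>P x)
      = (LINT r:{0..h}|lborel. J r - N r) + (\<integral>\<omega>. ?R \<omega> \<partial>P x)"
    using set_integral_diff(2)[OF J_int N_int] by (simp add: Mt first second)
  also have "\<bar>\<dots>\<bar> \<le> C * B * G * h * h + C * K * (B * h)\<^sup>2"
  proof (rule order_trans[OF abs_triangle_ineq add_mono])
    show "\<bar>LINT r:{0..h}|lborel. J r - N r\<bar> \<le> C * B * G * h * h"
      using set_integral_interval_bound[OF set_integral_diff(1)[OF J_int N_int] h JN] by simp
    show "\<bar>\<integral>\<omega>. ?R \<omega> \<partial>P x\<bar> \<le> C * K * (B * h)\<^sup>2"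
      using Rb by (rule abs_expectation_le)
  qed
  also have "\<dots> = exp (B * t) * (B * G + K * B\<^sup>2) * h\<^sup>2"
    by (simp add: C_def algebra_simps power2_eq_square)
  finally show ?thesis .
qed

text \<open>On \<open>{0..T}\<close> the factor \<open>exp (B * t)\<close> in the increment bound is
  at most \<open>exp (B * T)\<close>, so the bound is uniformly quadratic and the expectation keeps
  its initial value.\<close>

lemma feynman_kac:
  fixes w g V :: "'e \<Rightarrow> real"
  assumes w: "w \<in> Bb" and g: "g \<in> Bb" and V: "V \<in> Bb" and gV: "\<And>x. V x * w x = g x"
    and dyn: "\<And>s x. 0 \<le> s \<Longrightarrow> pf p s w x = w x + (LINT r:{0..s}|lborel. pf p r g x)"
    and T: "0 \<le> T"
  shows "(\<integral>\<omega>. w (\<omega> T) * exp (- path_int V T \<omega>) \<partial>P x) = w x"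
proof -
  obtain K G B where K: "\<And>x. \<bar>w x\<bar> \<le> K" "0 \<le> K" and G: "\<And>x. \<bar>g x\<bar> \<le> G" "0 \<le> G"
    and B: "\<And>x. \<bar>V x\<bar> \<le> B" "0 \<le> B"
    using BbE[OF w] BbE[OF g] BbE[OF V] by metis
  define \<Phi> where "\<Phi> t = (\<integral>\<omega>. w (\<omega> t) * exp (- path_int V t \<omega>) \<partial>P x)" for t
  let ?c = "B * G + K * B\<^sup>2"
  have "\<Phi> T = \<Phi> 0"
  proof (rule constant_if_quadratic_increments[OF T])
    \<comment> \<open>Steps of at most this length satisfy \<open>B * h \<le> 1\<close>; the added
      \<open>1\<close> covers the case \<open>B = 0\<close>.\<close>
    show "0 < 1 / (B + 1)"
      using B(2) by simp
    fix t h :: real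
    assume t: "0 \<le> t" and h: "0 < h" "h \<le> 1 / (B + 1)" and th: "t + h \<le> T"
    have "(B + 1) * h \<le> 1"
      using h(2) B(2) by (simp add: le_divide_eq mult.commute)
    then have Bh: "B * h \<le> 1"
      using h(1) by (simp add: algebra_simps)
    have "\<bar>\<Phi> (t + h) - \<Phi> t\<bar> \<le> exp (B * t) * ?c * h\<^sup>2"
      unfolding \<Phi>_def
      using feynman_kac_increment[OF w K(1) g G(1) V B(1) gV dyn t less_imp_le[OF h(1)] Bh] by simp
    also have "\<dots> \<le> exp (B * T) * ?c * h\<^sup>2"
      using th h(1) K(2) G(2) B(2) by (intro mult_right_mono) (auto intro: mult_left_mono)
    finally show "\<bar>\<Phi> (t + h) - \<Phi> t\<bar> \<le> exp (B * T) * ?c * h\<^sup>2" .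
  qed
  \<comment> \<open>At time \<open>0\<close> the bound \<open>B * 0\<close> forces the path integral
    to vanish.\<close>
  also have "\<Phi> 0 = (\<integral>\<omega>. w (\<omega> 0) \<partial>P x)"
    unfolding \<Phi>_def
    using path_int_abs_le[OF V order_refl _ B(1)] by (intro Bochner_Integration.integral_cong) auto
  also have "\<dots> = w x"
    by (rule start_integral[OF Bb_measurable[OF w]])
  finally show ?thesis
    by (simp add: \<Phi>_def)
qed

section \<open>Exponential bounds for path integrals, and their relation to empirical
  measures\<close>

text \<open>
  The set \<open>S\<close> need not be measurable (then its \<open>emeasure\<close> is \<open>0\<close>): measurability of
  \<open>{\<omega> \<in> \<Omega>. emp t \<omega> \<in> tau_nbhd \<mu> F \<epsilon>}\<close> is never needed.
\<close>

lemma emeasure_path_int_less: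
  fixes w g V :: "'e \<Rightarrow> real"
  assumes w: "w \<in> Bb" "\<And>x. w x \<le> K" "0 < \<epsilon>" "\<And>x. \<epsilon> \<le> w x"
    and g: "g \<in> Bb" and V: "V \<in> Bb" and gV: "\<And>x. V x * w x = g x"
    and dyn: "\<And>s x. 0 \<le> s \<Longrightarrow> pf p s w x = w x + (LINT r:{0..s}|lborel. pf p r g x)"
    and t: "0 \<le> t" and S: "S \<subseteq> {\<omega> \<in> \<Omega>. path_int V t \<omega> < - a * t}"
  shows "emeasure (P x) S \<le> ennreal (K / \<epsilon> * exp (- a * t))"
proof -
  obtain B where B: "\<And>x. \<bar>V x\<bar> \<le> B" using BbE[OF V] by metis
  let ?u = "\<lambda>\<omega>. exp (- path_int V t \<omega>)"
  have um[measurable]: "?u \<in> borel_measurable (P x)"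
    using measurable_P_if_Fo[OF path_int_measurable[OF Bb_measurable[OF V] t]] by measurable
  have ub: "\<bar>?u \<omega>\<bar> \<le> exp (B * t)" if "\<omega> \<in> \<Omega>" for \<omega>
    using path_int_abs_le[OF V t that B] by simp
  have int_u: "integrable (P x) ?u"
    using ub by (rule integrable_P_bounded[OF um])
  note [measurable] = measurable_compose[OF coord_measurable_P[OF t] Bb_measurable[OF w(1)], of x]
  have w0: "0 \<le> w y" "\<bar>w y\<bar> \<le> K" for y
    using w(2,3) w(4)[of y] by (auto simp: abs_le_iff intro: order_trans[of _ 0])
  \<comment> \<open>The lower bound on \<open>w\<close> inserts \<open>w (\<omega> t)\<close> into
    the expectation, Feynman-Kac evaluates it as \<open>w x\<close>, and the upper bound
    \<open>K\<close> removes the dependence on \<open>x\<close> and \<open>t\<close>.\<close>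
  have "\<epsilon> * (\<integral>\<omega>. ?u \<omega> \<partial>P x) = (\<integral>\<omega>. \<epsilon> * ?u \<omega> \<partial>P x)"
    by simp
  also have "\<dots> \<le> (\<integral>\<omega>. w (\<omega> t) * ?u \<omega> \<partial>P x)"
  proof (rule integral_mono)
    show "integrable (P x) (\<lambda>\<omega>. w (\<omega> t) * ?u \<omega>)"
      using ub w0 order_trans[OF abs_ge_zero w0(2)]
      by (intro integrable_P_bounded[where C = "K * exp (B * t)"]) (auto simp: abs_mult intro!: mult_mono)
  qed (use int_u w(4) in \<open>auto intro: mult_right_mono\<close>)
  also have "\<dots> = w x"
    by (rule feynman_kac[OF w(1) g V gV dyn t])
  also have "\<dots> \<le> K"
    by (rule w(2))
  finally have Eu: "(\<integral>\<omega>. ?u \<omega> \<partial>P x) \<le> K / \<epsilon>"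
    using w(3) by (simp add: le_divide_eq mult.commute)
  \<comment> \<open>Monotonicity of \<open>emeasure\<close> asks for measurability of the larger set
    only, and that set is defined by the measurable function \<open>?u\<close>.\<close>
  have "S \<subseteq> {\<omega> \<in> space (P x). exp (a * t) \<le> ?u \<omega>}"
    using S by fastforce
  then have "emeasure (P x) S \<le> emeasure (P x) {\<omega> \<in> space (P x). exp (a * t) \<le> ?u \<omega>}"
    by (rule emeasure_mono) measurable
  also have "\<dots> \<le> ennreal (1 / exp (a * t) * (\<integral>\<omega>. ?u \<omega> \<partial>P x))"
    by (rule integral_Markov_inequality[OF int_u]) auto
  also have "\<dots> \<le> ennreal (K / \<epsilon> * exp (- a * t))"
    using Eu by (intro ennreal_leI) (simp add: exp_minus field_simps)
  finally show ?thesis .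
qed

text \<open>Transporting the integral along \<omega> requires the path to be Borel on
  \<open>{0..t}\<close>; this comes from the clamped path, which agrees with \<omega> there.\<close>

lemma integral_emp:
  fixes V :: "'e \<Rightarrow> real"
  assumes V: "V \<in> borel_measurable borel" and t: "0 < t" and \<omega>: "\<omega> \<in> \<Omega>"
  shows "integral\<^sup>L (emp t \<omega>) V = path_int V t \<omega> / t"
proof -
  let ?L = "restrict_space lborel {0..t}"
  have "(\<lambda>s. \<omega> (max 0 (min t s))) \<in> measurable borel borel"
    using measurable_compose[OF measurable_Pair2' path_measurable_Fo[of t], of \<omega>] \<omega> t by simp
  then have "(\<lambda>s. \<omega> (max 0 (min t s))) \<in> measurable ?L borel"
    by (intro measurable_restrict_space1) simp
  then have m: "\<omega> \<in> measurable ?L borel"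
    by (rule measurable_cong[THEN iffD1, rotated]) (auto simp: space_restrict_space)
  \<comment> \<open>Scaling by \<open>1 / t\<close> is rewritten as a constant density, for which
    the rule on real-valued integrals is available.\<close>
  have "emp t \<omega> = density (distr ?L borel \<omega>) (\<lambda>_. ennreal (1 / t))"
    unfolding emp_def by (rule measure_eqI) (auto simp: emeasure_density_const)
  then have "integral\<^sup>L (emp t \<omega>) V = 1 / t * integral\<^sup>L (distr ?L borel \<omega>) V"
    using V t by (simp add: integral_density)
  also have "integral\<^sup>L (distr ?L borel \<omega>) V = path_int V t \<omega>"
    unfolding integral_distr[OF m V] path_int_def set_lebesgue_integral_def
    by (subst integral_restrict_space) auto
  finally show ?thesis
    by simp
qed

end

section \<open>Logarithmic scale and choice of the neighborhood\<close>

lemma elog_mono: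
  assumes "r \<le> ennreal b" "0 < b"
  shows "elog r \<le> ereal (ln b)"
proof (cases r)
  case (real s)
  then show ?thesis
    using assms by (auto simp: elog_def)
qed (use assms in \<open>auto simp: elog_def top_unique\<close>)

theorem theorem1p8:
  fixes \<phi> :: "'s::polish_space \<Rightarrow> 'e::t2_space"
    and m :: "'e measure"
    and p :: "real \<Rightarrow> 'e \<Rightarrow> 'e measure"
    and T :: "real \<Rightarrow> ('e \<Rightarrow> real) \<Rightarrow> ('e \<Rightarrow> real)"
    and \<Omega> :: "(real \<Rightarrow> 'e) set"
    and P :: "'e \<Rightarrow> (real \<Rightarrow> 'e) measure"
    and \<mu> :: "'e measure"
    and a :: real
  \<comment> \<open>E is a Lusin space\<close>
  assumes lusin: "continuous_on UNIV \<phi>" "bij \<phi>"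
  \<comment> \<open>B(E) is generated by the real-valued continuous functions\<close>
  and borel_cont: "sets (borel :: 'e measure) =
      sigma_sets UNIV {f -` B | f B. continuous_on UNIV (f :: 'e \<Rightarrow> real) \<and> B \<in> sets borel}"
  \<comment> \<open>m is a sigma-finite measure on (E, B(E)) with m(E) > 0\<close>
  and m: "sets m = sets borel" "sigma_finite_measure m" "emeasure m UNIV > 0"
  \<comment> \<open>p is a transition probability function\<close>
  and p_prob: "\<And>t x. t \<ge> 0 \<Longrightarrow> prob_space (p t x) \<and> sets (p t x) = sets borel"
  and p_meas: "\<And>A. A \<in> sets borel \<Longrightarrow>
      (\<lambda>(t, x). emeasure (p t x) A) \<in> borel_measurable
        (restrict_space ((borel :: real measure) \<Otimes>\<^sub>M (borel :: 'e measure)) ({0..} \<times> UNIV))"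
  and p_zero: "\<And>x. p 0 x = return borel x"
  \<comment> \<open>(T_t) is a strongly continuous semigroup of bounded linear operators on L2(m),
      acting on representatives and compatible with m-a.e. equality\<close>
  and T_L2: "\<And>t f. t \<ge> 0 \<Longrightarrow> f \<in> L2 m \<Longrightarrow> T t f \<in> L2 m"
  and T_wd: "\<And>t f g. t \<ge> 0 \<Longrightarrow> f \<in> L2 m \<Longrightarrow> g \<in> L2 m \<Longrightarrow> (AE x in m. f x = g x) \<Longrightarrow>
      AE x in m. T t f x = T t g x"
  and T_lin: "\<And>t f g c. t \<ge> 0 \<Longrightarrow> f \<in> L2 m \<Longrightarrow> g \<in> L2 m \<Longrightarrow>
      AE x in m. T t (\<lambda>y. c * f y + g y) x = c * T t f x + T t g x"
  and T_bdd: "\<And>t. t \<ge> 0 \<Longrightarrow> \<exists>C. \<forall>f \<in> L2 m.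
      (\<integral>x. (T t f x)\<^sup>2 \<partial>m) \<le> C * (\<integral>x. (f x)\<^sup>2 \<partial>m)"
  and T_zero: "\<And>f. f \<in> L2 m \<Longrightarrow> AE x in m. T 0 f x = f x"
  and T_semigroup: "\<And>t s f. t \<ge> 0 \<Longrightarrow> s \<ge> 0 \<Longrightarrow> f \<in> L2 m \<Longrightarrow>
      AE x in m. T (t + s) f x = T t (T s f) x"
  and T_strong: "\<And>f. f \<in> L2 m \<Longrightarrow>
      ((\<lambda>t. \<integral>x. (T t f x - f x)\<^sup>2 \<partial>m) \<longlongrightarrow> 0) (at_right 0)"
  and T_p: "\<And>t f. t \<ge> 0 \<Longrightarrow> f \<in> Bb \<Longrightarrow> integrable m (\<lambda>x. (f x)\<^sup>2) \<Longrightarrow>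
      AE x in m. pf p t f x = T t f x"
  \<comment> \<open>(Omega, F^o_t, X_t, P^x) is a progressively measurable Markov process with
      transition function p, X_t(omega) = omega(t), P^x(X_0 = x) = 1, infinite lifetime\<close>
  and P_prob: "\<And>x. prob_space (P x) \<and> sets (P x) = sets (Foo \<Omega>)"
  and P_meas: "\<And>\<Lambda>. \<Lambda> \<in> sets (Foo \<Omega>) \<Longrightarrow> (\<lambda>x. emeasure (P x) \<Lambda>) \<in> borel_measurable borel"
  and P_start: "\<And>x. emeasure (P x) {\<omega> \<in> \<Omega>. \<omega> 0 = x} = 1"
  and P_markov: "\<And>x t s A \<Lambda>. t \<ge> 0 \<Longrightarrow> s \<ge> 0 \<Longrightarrow> A \<in> sets borel \<Longrightarrow> \<Lambda> \<in> sets (Fo \<Omega> t) \<Longrightarrow>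
      emeasure (P x) (\<Lambda> \<inter> {\<omega> \<in> \<Omega>. \<omega> (t + s) \<in> A}) =
      set_nn_integral (P x) \<Lambda> (\<lambda>\<omega>. emeasure (p s (\<omega> t)) A)"
  and X_prog: "\<And>t. t \<ge> 0 \<Longrightarrow>
      (\<lambda>(s, \<omega>). \<omega> s) \<in> measurable (restrict_space (borel :: real measure) {0..t} \<Otimes>\<^sub>M Fo \<Omega> t) borel"
  \<comment> \<open>the statement\<close>
  and mu: "\<mu> \<in> probs"
  and a: "ereal a < Ihat p m \<mu>"
  shows "\<exists>F \<epsilon>. finite F \<and> F \<noteq> {} \<and> F \<subseteq> Bb \<and> \<epsilon> > 0 \<and>
    Limsup at_top (\<lambda>t::real. ereal (1 / t) *
        (SUP x. elog (emeasure (P x) {\<omega> \<in> \<Omega>. emp t \<omega> \<in> tau_nbhd \<mu> F \<epsilon>}))) \<le> - ereal a"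
proof -
  interpret markov_family p \<Omega> P
    by unfold_locales (fact p_prob p_meas P_prob P_start P_markov X_prog)+
  obtain u t0 \<eta> \<epsilon> where u: "u \<in> Dset m" and t0: "t0 > 0" and \<eta>: "\<eta> \<ge> 0" and \<epsilon>: "\<epsilon> > 0"
    and less: "(\<integral>x. Lhat_rep p u t0 \<eta> x / (vrep p u t0 \<eta> x + \<epsilon>) \<partial>\<mu>) < - a"
  proof -
    have "(INF r \<in> {(u, t, \<eta>, \<epsilon>). u \<in> Dset m \<and> t > 0 \<and> \<eta> \<ge> 0 \<and> \<epsilon> > 0}.
      (case r of (u, t, \<eta>, \<epsilon>) \<Rightarrow>
        ereal (integral\<^sup>L \<mu> (\<lambda>x. Lhat_rep p u t \<eta> x / (vrep p u t \<eta> x + \<epsilon>))))) < ereal (- a)"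
      using a unfolding Ihat_def by (subst (asm) ereal_less_uminus_reorder) simp
    then show ?thesis
      unfolding INF_less_iff using that by auto
  qed
  define g where "g = Lhat_rep p u t0 \<eta>"
  define w where "w x = vrep p u t0 \<eta> x + \<epsilon>" for x
  define V where "V x = g x / w x" for x
  have uB: "u \<in> Bb" and u0: "\<And>x. 0 \<le> u x"
    using u by (auto simp: Dset_def)
  have g: "g \<in> Bb"
    unfolding g_def by (rule Lhat_rep_Bb[OF uB t0 \<eta>])
  have w_ge: "\<epsilon> \<le> w x" for x
    using vrep_nonneg[OF u0 t0] by (simp add: w_def)
  obtain C where C: "0 \<le> C" "\<And>x. \<bar>vrep p u t0 \<eta> x\<bar> \<le> C"
    using BbE[OF vrep_Bb[OF uB t0 \<eta>]] by metis
  define K where "K = C + \<epsilon>"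
  have w_le: "w x \<le> K" for x
    using C(2)[of x] by (simp add: w_def K_def)
  have wm: "w \<in> borel_measurable borel"
    unfolding w_def using Bb_measurable[OF vrep_Bb[OF uB t0 \<eta>]] by measurable
  have w: "w \<in> Bb"
  proof (rule BbI[OF wm])
    show "\<bar>w x\<bar> \<le> K" for x
      using w_ge[of x] w_le[of x] \<epsilon> by simp
  qed
  have V: "V \<in> Bb"
  proof -
    obtain G where G: "0 \<le> G" "\<And>x. \<bar>g x\<bar> \<le> G" using BbE[OF g] by metis
    show ?thesis
    proof (rule BbI)
      show "V \<in> borel_measurable borel"
        unfolding V_def using Bb_measurable[OF g] wm by measurable
      show "\<bar>V x\<bar> \<le> G / \<epsilon>" for x
        using G w_ge[of x] \<epsilon> by (simp add: V_def abs_divide) (intro frac_le, auto)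
    qed
  qed
  have gV: "V x * w x = g x" for x
    using w_ge[of x] \<epsilon> by (simp add: V_def)
  have dyn: "pf p s w x = w x + (LINT r:{0..s}|lborel. pf p r g x)" if "0 \<le> s" for s x
    using dynkin_vrep[OF uB t0 \<eta> that, of x] pf_add_const[OF that vrep_Bb[OF uB t0 \<eta>], of \<epsilon> x]
    by (simp add: w_def[abs_def] g_def)
  \<comment> \<open>The gap left by the strict inequality \<open>less\<close>: a measure within
    \<delta> of \<mu> when tested on \<open>V\<close> gives \<open>V\<close> an integral below
    \<open>- a\<close>.\<close>
  define \<delta> where "\<delta> = - a - integral\<^sup>L \<mu> V"
  have \<delta>: "0 < \<delta>"
    using less by (simp add: \<delta>_def V_def[abs_def] g_def w_def)
  let ?S = "\<lambda>t. {\<omega> \<in> \<Omega>. emp t \<omega> \<in> tau_nbhd \<mu> {V} \<delta>}"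
  have K\<epsilon>: "0 < K / \<epsilon>"
    using C(1) \<epsilon> by (simp add: K_def)
  \<comment> \<open>A bound for each fixed positive \<open>t\<close>, uniform in the starting point;
    the prefactor \<open>K / \<epsilon>\<close> survives only as
    \<open>ln (K / \<epsilon>) / t\<close>, which tends to \<open>0\<close>.\<close>
  have bound: "ereal (1 / t) * (SUP x. elog (emeasure (P x) (?S t))) \<le> ereal (ln (K / \<epsilon>) / t - a)"
    if t: "0 < t" for t
  proof -
    have S: "?S t \<subseteq> {\<omega> \<in> \<Omega>. path_int V t \<omega> < - a * t}"
    proof safe
      fix \<omega> assume \<omega>: "\<omega> \<in> \<Omega>" and "emp t \<omega> \<in> tau_nbhd \<mu> {V} \<delta>"
      then have "\<bar>path_int V t \<omega> / t - integral\<^sup>L \<mu> V\<bar> < - a - integral\<^sup>L \<mu> V"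
        using integral_emp[OF Bb_measurable[OF V] t \<omega>] by (simp add: tau_nbhd_def \<delta>_def)
      then have "path_int V t \<omega> / t < - a"
        by linarith
      then show "path_int V t \<omega> < - a * t"
        using t by (simp add: divide_less_eq)
    qed
    have "0 < K / \<epsilon> * exp (- a * t)"
      using K\<epsilon> by (rule mult_pos_pos) simp
    then have "(SUP x. elog (emeasure (P x) (?S t))) \<le> ereal (ln (K / \<epsilon> * exp (- a * t)))"
      by (intro SUP_least elog_mono
          emeasure_path_int_less[OF w w_le \<epsilon> w_ge g V gV dyn less_imp_le[OF t] S])
    then have "ereal (1 / t) * (SUP x. elog (emeasure (P x) (?S t))) \<le> ereal (1 / t) * ereal (ln (K / \<epsilon> * exp (- a * t)))"
      using t by (intro ereal_mult_left_mono) auto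
    also have "ln (K / \<epsilon> * exp (- a * t)) = ln (K / \<epsilon>) - a * t"
      using K\<epsilon> by (subst ln_mult) auto
    also have "ereal (1 / t) * ereal (ln (K / \<epsilon>) - a * t) = ereal (ln (K / \<epsilon>) / t - a)"
      using t by (simp add: field_simps)
    finally show ?thesis .
  qed
  have "((\<lambda>t. ln (K / \<epsilon>) / t - a) \<longlongrightarrow> 0 - a) at_top"
    by (intro tendsto_diff tendsto_const tendsto_divide_0[OF tendsto_const]
        filterlim_at_top_imp_at_infinity filterlim_ident)
  then have "Limsup at_top (\<lambda>t. ereal (ln (K / \<epsilon>) / t - a)) = ereal (- a)"
    by (intro lim_imp_Limsup) auto
  moreover have "Limsup at_top (\<lambda>t. ereal (1 / t) * (SUP x. elog (emeasure (P x) (?S t))))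
      \<le> Limsup at_top (\<lambda>t. ereal (ln (K / \<epsilon>) / t - a))"
    \<comment> \<open>Since \<open>bound\<close> holds for positive \<open>t\<close>, the comparison
      of upper limits is made eventually at infinity.\<close>
    using bound by (intro Limsup_mono eventually_mono[OF eventually_gt_at_top[of 0]]) auto
  ultimately show ?thesis
    using V \<delta> by (intro exI[of _ "{V}"] exI[of _ \<delta>]) auto
qed

end
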